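(* Let $(X,\mathbf R)$ be a symmetric association scheme with $D$ classes which is metric with respect to $A_0,\dots,A_D$ and cometric with respect to $E_0,\dots,E_D$. Fix $x\in X$, write $E_i^*=E_i^*(x)$, $T=T(x)$. Let $\chi\in V$ be a code and set $\delta_x=\delta_x(\chi)$, $\delta^*=\delta^*(\chi)$. Suppose $t\in\{1,\dots,D\}$ is such that for every $1\le r\le t$ at least one of the following holds: $$|\{r\le j\le D-r: E_j\chi\ne0\}|\le\delta_x-r,\qquad |\{r\le i\le D-r:E_i^*\chi\ne0\}|\le\delta^*-r.$$ Suppose every irreducible $T$-module with displacement zero and endpoint at most $t$ is thin. Then: (i) for every $F\in T$, $F\chi$ is orthogonal to $V_{i,D-i}\cap(M\hat x)^\perp$ whenever $1\le i\le t$; (ii) for every $F\in T$, $F\chi$ is orthogonal to $V_{D-j,j}\cap(M\hat x)^\perp$ whenever $1\le j\le t$.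
   Context: $(X,\mathbf R)$ is a symmetric association scheme with associate matrices $A_0=I,\dots,A_D$, Bose–Mesner algebra $M$, primitive idempotents $E_0=|X|^{-1}J,\dots,E_D$. Metric: $(X,R_1)$ is distance-regular with $R_i$ its distance-$i$ relation. Cometric: each $E_j$ is a polynomial of degree exactly $j$ in $E_1$ under entrywise multiplication. $V=\mathbb C^X$ with standard basis $\{\hat y\}$ and standard Hermitian inner product; $(M\hat x)^\perp$ is the orthogonal complement of $M\hat x=\{B\hat x: B\in M\}$. $E_i^*(x)$ is diagonal with $(E_i^*(x))_{yy}=(A_i)_{xy}$; $A_i^*(x)$ diagonal with $(A_i^*(x))_{yy}=|X|(E_i)_{xy}$; $T(x)$ is the algebra generated by $M$ and the $A_i^*(x)$. For an irreducible $T$-module $W$: endpoint $r(W)=\min\{i:E_i^*W\ne0\}$, dual endpoint $r^*(W)=\min\{j:E_jW\ne0\}$, diameter $d(W)=|\{i:E_i^*W\ne0\}|-1$, displacement $\eta(W)=r(W)+r^*(W)+d(W)-D$; thin means $\dim E_i^*W\le1$ for all $i$. For $0\le i,j\le D$, $V_{ij}=\bigl(\sum_{k=0}^iE_k^*V\bigr)\cap\bigl(\sum_{\ell=0}^jE_\ell V\bigr)$. A code is $\chi\notin E_0V$ with $\chi\notin E_0^*(z)V$ for all $z$; $\delta_x(\chi)=\min\{i\ne0:E_i^*(x)\chi\ne0\}$, $\delta^*(\chi)=\min\{j\ne0:E_j\chi\ne0\}$. *)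

theory Defs
  imports Complex_Main "HOL-Computational_Algebra.Polynomial"
begin

text \<open>The vertex set X is a finite type 'x; V = 'x => complex; matrices over X
  are functions 'x => 'x => complex.  The scheme is given by the relation index
  function R (R y z = i iff (y,z) in R_i) and the number of classes D.\<close>

type_synonym 'x cvec = "'x \<Rightarrow> complex"
type_synonym 'x cmat = "'x \<Rightarrow> 'x \<Rightarrow> complex"

definition zvec :: "'x cvec" where "zvec = (\<lambda>_. 0)"

definition mmult :: "('x::finite) cmat \<Rightarrow> 'x cmat \<Rightarrow> 'x cmat" where
  "mmult A B = (\<lambda>y z. \<Sum>w\<in>UNIV. A y w * B w z)"

definition mapply :: "('x::finite) cmat \<Rightarrow> 'x cvec \<Rightarrow> 'x cvec" where
  "mapply A v = (\<lambda>y. \<Sum>w\<in>UNIV. A y w * v w)"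

definition idm :: "'x cmat" where "idm = (\<lambda>y z. if y = z then 1 else 0)"

definition cinner :: "('x::finite) cvec \<Rightarrow> 'x cvec \<Rightarrow> complex" where
  "cinner u v = (\<Sum>y\<in>UNIV. u y * cnj (v y))"

definition hatv :: "'x \<Rightarrow> 'x cvec" where "hatv x = (\<lambda>y. if y = x then 1 else 0)"

definition adjm :: "('x \<Rightarrow> 'x \<Rightarrow> nat) \<Rightarrow> nat \<Rightarrow> 'x cmat" where
  "adjm R i = (\<lambda>y z. if R y z = i then 1 else 0)"

definition BM :: "('x \<Rightarrow> 'x \<Rightarrow> nat) \<Rightarrow> nat \<Rightarrow> 'x cmat set" where
  "BM R D = {B. \<exists>c::nat \<Rightarrow> complex. B = (\<lambda>y z. \<Sum>i\<le>D. c i * adjm R i y z)}"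

definition sym_assoc_scheme :: "('x::finite \<Rightarrow> 'x \<Rightarrow> nat) \<Rightarrow> nat \<Rightarrow> bool" where
  "sym_assoc_scheme R D \<longleftrightarrow>
     (\<forall>y z. R y z \<le> D) \<and>
     (\<forall>y z. R y z = 0 \<longleftrightarrow> y = z) \<and>
     (\<forall>y z. R y z = R z y) \<and>
     (\<forall>i\<le>D. \<exists>y z. R y z = i) \<and>
     (\<forall>i j k. i \<le> D \<longrightarrow> j \<le> D \<longrightarrow> k \<le> D \<longrightarrow>
        (\<exists>p::nat. \<forall>y z. R y z = k \<longrightarrow> card {w. R y w = i \<and> R w z = j} = p))"

definition prim_idempotents ::
    "('x::finite \<Rightarrow> 'x \<Rightarrow> nat) \<Rightarrow> nat \<Rightarrow> (nat \<Rightarrow> 'x cmat) \<Rightarrow> bool" where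
  "prim_idempotents R D E \<longleftrightarrow>
     E 0 = (\<lambda>y z. 1 / of_nat (card (UNIV :: 'x set))) \<and>
     (\<forall>i\<le>D. E i \<in> BM R D) \<and>
     (\<forall>i\<le>D. E i \<noteq> (\<lambda>y z. 0)) \<and>
     (\<forall>i\<le>D. \<forall>j\<le>D. mmult (E i) (E j) = (if i = j then E i else (\<lambda>y z. 0))) \<and>
     (\<lambda>y z. \<Sum>i\<le>D. E i y z) = idm"

definition walk :: "('x \<Rightarrow> 'x \<Rightarrow> nat) \<Rightarrow> nat \<Rightarrow> 'x \<Rightarrow> 'x \<Rightarrow> bool" where
  "walk R n y z \<longleftrightarrow> (\<exists>p::nat \<Rightarrow> 'x. p 0 = y \<and> p n = z \<and> (\<forall>k<n. R (p k) (p (Suc k)) = 1))"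

definition metric :: "('x \<Rightarrow> 'x \<Rightarrow> nat) \<Rightarrow> bool" where
  "metric R \<longleftrightarrow> (\<forall>y z. walk R (R y z) y z \<and> (\<forall>n < R y z. \<not> walk R n y z))"

definition cometric :: "nat \<Rightarrow> (nat \<Rightarrow> 'x cmat) \<Rightarrow> bool" where
  "cometric D E \<longleftrightarrow>
     (\<forall>j\<le>D. \<exists>p::complex poly. degree p = j \<and> E j = (\<lambda>y z. poly p (E 1 y z)))"

definition Estar :: "('x \<Rightarrow> 'x \<Rightarrow> nat) \<Rightarrow> 'x \<Rightarrow> nat \<Rightarrow> 'x cmat" where
  "Estar R x i = (\<lambda>y z. if y = z then adjm R i x y else 0)"

definition Astar :: "(nat \<Rightarrow> ('x::finite) cmat) \<Rightarrow> 'x \<Rightarrow> nat \<Rightarrow> 'x cmat" where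
  "Astar E x i = (\<lambda>y z. if y = z then of_nat (card (UNIV :: 'x set)) * E i x y else 0)"

inductive_set Talg :: "('x::finite \<Rightarrow> 'x \<Rightarrow> nat) \<Rightarrow> nat \<Rightarrow> (nat \<Rightarrow> 'x cmat) \<Rightarrow> 'x \<Rightarrow> 'x cmat set"
  for R D E x where
  gen_A: "i \<le> D \<Longrightarrow> adjm R i \<in> Talg R D E x"
| gen_Astar: "i \<le> D \<Longrightarrow> Astar E x i \<in> Talg R D E x"
| add: "F \<in> Talg R D E x \<Longrightarrow> G \<in> Talg R D E x \<Longrightarrow> (\<lambda>y z. F y z + G y z) \<in> Talg R D E x"
| smult: "F \<in> Talg R D E x \<Longrightarrow> (\<lambda>y z. c * F y z) \<in> Talg R D E x"
| mult: "F \<in> Talg R D E x \<Longrightarrow> G \<in> Talg R D E x \<Longrightarrow> mmult F G \<in> Talg R D E x"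

definition csubspace :: "'x cvec set \<Rightarrow> bool" where
  "csubspace W \<longleftrightarrow> zvec \<in> W \<and> (\<forall>u\<in>W. \<forall>v\<in>W. (\<lambda>y. u y + v y) \<in> W) \<and>
     (\<forall>c. \<forall>u\<in>W. (\<lambda>y. c * u y) \<in> W)"

definition Tmodule :: "('x::finite \<Rightarrow> 'x \<Rightarrow> nat) \<Rightarrow> nat \<Rightarrow> (nat \<Rightarrow> 'x cmat) \<Rightarrow> 'x \<Rightarrow> 'x cvec set \<Rightarrow> bool" where
  "Tmodule R D E x W \<longleftrightarrow> csubspace W \<and> (\<forall>F\<in>Talg R D E x. \<forall>w\<in>W. mapply F w \<in> W)"

definition irred_Tmodule :: "('x::finite \<Rightarrow> 'x \<Rightarrow> nat) \<Rightarrow> nat \<Rightarrow> (nat \<Rightarrow> 'x cmat) \<Rightarrow> 'x \<Rightarrow> 'x cvec set \<Rightarrow> bool" where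
  "irred_Tmodule R D E x W \<longleftrightarrow> Tmodule R D E x W \<and> W \<noteq> {zvec} \<and>
     (\<forall>U. Tmodule R D E x U \<and> U \<subseteq> W \<longrightarrow> U = {zvec} \<or> U = W)"

definition nz_on :: "('x::finite) cmat \<Rightarrow> 'x cvec set \<Rightarrow> bool" where
  "nz_on P W \<longleftrightarrow> (\<exists>w\<in>W. mapply P w \<noteq> zvec)"

definition endpoint :: "('x::finite \<Rightarrow> 'x \<Rightarrow> nat) \<Rightarrow> nat \<Rightarrow> 'x \<Rightarrow> 'x cvec set \<Rightarrow> nat" where
  "endpoint R D x W = (LEAST i. i \<le> D \<and> nz_on (Estar R x i) W)"

definition dual_endpoint :: "nat \<Rightarrow> (nat \<Rightarrow> ('x::finite) cmat) \<Rightarrow> 'x cvec set \<Rightarrow> nat" where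
  "dual_endpoint D E W = (LEAST j. j \<le> D \<and> nz_on (E j) W)"

definition diameter :: "('x::finite \<Rightarrow> 'x \<Rightarrow> nat) \<Rightarrow> nat \<Rightarrow> 'x \<Rightarrow> 'x cvec set \<Rightarrow> nat" where
  "diameter R D x W = card {i. i \<le> D \<and> nz_on (Estar R x i) W} - 1"

definition displacement :: "('x::finite \<Rightarrow> 'x \<Rightarrow> nat) \<Rightarrow> nat \<Rightarrow> (nat \<Rightarrow> 'x cmat) \<Rightarrow> 'x \<Rightarrow> 'x cvec set \<Rightarrow> int" where
  "displacement R D E x W = int (endpoint R D x W) + int (dual_endpoint D E W)
      + int (diameter R D x W) - int D"

definition thin :: "('x::finite \<Rightarrow> 'x \<Rightarrow> nat) \<Rightarrow> nat \<Rightarrow> 'x \<Rightarrow> 'x cvec set \<Rightarrow> bool" where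
  "thin R D x W \<longleftrightarrow>
     (\<forall>i\<le>D. \<exists>u. \<forall>w\<in>W. \<exists>c. mapply (Estar R x i) w = (\<lambda>y. c * u y))"

definition Vij :: "('x::finite \<Rightarrow> 'x \<Rightarrow> nat) \<Rightarrow> (nat \<Rightarrow> 'x cmat) \<Rightarrow> 'x \<Rightarrow> nat \<Rightarrow> nat \<Rightarrow> 'x cvec set" where
  "Vij R E x i j =
     {v. \<exists>f. v = (\<lambda>y. \<Sum>k\<le>i. mapply (Estar R x k) (f k) y)} \<inter>
     {v. \<exists>f. v = (\<lambda>y. \<Sum>l\<le>j. mapply (E l) (f l) y)}"

definition Mx_perp :: "('x::finite \<Rightarrow> 'x \<Rightarrow> nat) \<Rightarrow> nat \<Rightarrow> 'x \<Rightarrow> 'x cvec set" where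
  "Mx_perp R D x = {v. \<forall>B\<in>BM R D. cinner (mapply B (hatv x)) v = 0}"

definition is_code :: "('x::finite \<Rightarrow> 'x \<Rightarrow> nat) \<Rightarrow> (nat \<Rightarrow> 'x cmat) \<Rightarrow> 'x cvec \<Rightarrow> bool" where
  "is_code R E \<chi> \<longleftrightarrow> \<chi> \<notin> range (mapply (E 0)) \<and> (\<forall>z. \<chi> \<notin> range (mapply (Estar R z 0)))"

definition min_dist :: "('x::finite \<Rightarrow> 'x \<Rightarrow> nat) \<Rightarrow> nat \<Rightarrow> 'x \<Rightarrow> 'x cvec \<Rightarrow> nat" where
  "min_dist R D x \<chi> = (LEAST i. i \<noteq> 0 \<and> i \<le> D \<and> mapply (Estar R x i) \<chi> \<noteq> zvec)"

definition dual_degree :: "nat \<Rightarrow> (nat \<Rightarrow> ('x::finite) cmat) \<Rightarrow> 'x cvec \<Rightarrow> nat" where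
  "dual_degree D E \<chi> = (LEAST j. j \<noteq> 0 \<and> j \<le> D \<and> mapply (E j) \<chi> \<noteq> zvec)"

end

theory Submission
  imports Defs "HOL-Analysis.Finite_Cartesian_Product" "HOL-Analysis.Linear_Algebra"
    "HOL-Library.Function_Algebras"
begin

text \<open>Let \<open>W\<close> be an irreducible \<open>T\<close>-module orthogonal to \<open>M x\<close> that meets \<open>V(i, D - i)\<close>. If the support
  of \<open>W\<close> is the interval from \<open>r\<close> to \<open>r + d\<close> and its dual support the one from \<open>r*\<close> to
  \<open>r* + d\<close>, the split decomposition of \<open>W\<close> shows \<open>r + r* + d \<le> D\<close>, while
  \<open>2r + d \<ge> D\<close> and \<open>2r* + d \<ge> D\<close> hold in general. Hence \<open>r = r*\<close>, \<open>d = D - 2r\<close>, the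
  displacement is zero and \<open>W\<close> is thin. Let \<open>\<psi>\<close> be the projection of the code on \<open>W\<close>. If it lies in
  at most \<open>m\<close> eigenspaces, a polynomial of degree \<open>m\<close> in the adjacency matrix annihilates it; but on
  a thin module the adjacency matrix lowers the first nonzero component of a vector by exactly
  one step, so \<open>\<psi> = 0\<close> as soon as its components below \<open>r + m\<close> vanish. The other
  alternative is dual, because thin irreducible modules are dual thin. Thus the code is
  orthogonal to \<open>W\<close>.\<close>

text \<open>A vector of V(i, D - i) orthogonal to \<open>M x\<close> need not lie in an irreducible
  module. The reduction works because \<open>T\<close> is closed under adjoints: the orthogonal
  complement of a submodule is a submodule, so the projections commute with \<open>T\<close> and
  preserve every vanishing component, both of the vector and of the code. Splitting submodules
  inside the complement of \<open>M x\<close>, by induction on dimension, therefore ends in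
  irreducible ones. That complement is itself a module, and its vectors vanish at \<open>x\<close>.
  Hence \<open>r\<close> is at least 1, the weight condition is available at \<open>r\<close>, and
  the index 0, which minimum distance and dual degree ignore, lies outside both supports. Most of
  the scheme theory serves to show that the dual matrices satisfy the same axioms as the associate
  matrices. The idempotents have to be real, and the Krein parameters have to obey the triangle
  inequalities, with nonzero entries next to the diagonal for index 1.\<close>

unbundle no vec_syntax

declare One_nat_def [simp del]

section \<open>Modules for a pair of polynomial actions\<close>

text \<open>In the application \<open>A\<close> and \<open>E\<close> are the associate matrices and the primitive idempotents of
  the scheme, and \<open>As\<close> and \<open>Es\<close> are their duals with respect to a base vertex. The assumptions are
  self-dual, so every fact about \<open>(A, E, As, Es)\<close> also holds for \<open>(As, Es, A, E)\<close>.\<close>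

locale polynomial_action = vector_space scale
  for scale :: "'a::field \<Rightarrow> 'v::ab_group_add \<Rightarrow> 'v" +
  fixes D :: nat and A E Es :: "nat \<Rightarrow> 'v \<Rightarrow> 'v"
  assumes D_pos: "1 \<le> D"
    and hom_A: "i \<le> D \<Longrightarrow> module_hom scale scale (A i)"
    and hom_E: "i \<le> D \<Longrightarrow> module_hom scale scale (E i)"
    and E_E: "i \<le> D \<Longrightarrow> j \<le> D \<Longrightarrow> E i (E j v) = (if i = j then E i v else 0)"
    and E_sum: "(\<Sum>j\<le>D. E j v) = v"
    and A1_E_ex: "j \<le> D \<Longrightarrow> \<exists>\<theta>. \<forall>v. A 1 (E j v) = scale \<theta> (E j v)"
    and E_span: "j \<le> D \<Longrightarrow> \<exists>c. \<forall>v. E j v = (\<Sum>i\<le>D. scale (c i) (A i v))"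
    and A_0: "A 0 v = v"
    and A_rec: "j \<le> D \<Longrightarrow> \<exists>p. (\<forall>v. A 1 (A j v) = (\<Sum>k\<le>D. scale (p k) (A k v))) \<and>
      (\<forall>k\<le>D. (k + 1 < j \<or> j + 1 < k \<longrightarrow> p k = 0) \<and> (k + 1 = j \<or> k = j + 1 \<longrightarrow> p k \<noteq> 0))"
    and Es_A_Es: "i \<le> D \<Longrightarrow> j \<le> D \<Longrightarrow> k \<le> D \<Longrightarrow>
      i + j < k \<or> j + k < i \<or> i + k < j \<Longrightarrow> Es i (A j (Es k v)) = 0"
begin

section \<open>Eigenvalues and polynomials in \<open>A 1\<close>\<close>

definition eigval :: "nat \<Rightarrow> 'a" where
  "eigval j = (SOME \<theta>. \<forall>v. A 1 (E j v) = scale \<theta> (E j v))"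

lemma A1_E: "j \<le> D \<Longrightarrow> A 1 (E j v) = scale (eigval j) (E j v)"
  using someI_ex[OF A1_E_ex[of j]] unfolding eigval_def by blast

lemma hom_A1: "module_hom scale scale (A 1)"
  by (rule hom_A[OF D_pos])

lemma E_A1: assumes "j \<le> D" shows "E j (A 1 v) = scale (eigval j) (E j v)"
proof -
  have "E j (A 1 v) = E j (A 1 (\<Sum>l\<le>D. E l v))" by (simp add: E_sum)
  also have "\<dots> = (\<Sum>l\<le>D. E j (scale (eigval l) (E l v)))"
    by (simp add: module_hom.sum[OF hom_A1] module_hom.sum[OF hom_E[OF assms]] A1_E)
  also have "\<dots> = (\<Sum>l\<le>D. if l = j then scale (eigval j) (E j v) else 0)"
    by (rule sum.cong) (auto simp: module_hom.scale[OF hom_E[OF assms]] E_E assms)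
  finally show ?thesis using assms by simp
qed

lemma A_recE:
  assumes "j \<le> D"
  obtains p where "\<And>v. A 1 (A j v) = (\<Sum>k\<le>D. scale (p k) (A k v))"
    "\<And>k. k \<le> D \<Longrightarrow> k + 1 < j \<or> j + 1 < k \<Longrightarrow> p k = 0"
    "\<And>k. k \<le> D \<Longrightarrow> k + 1 = j \<or> k = j + 1 \<Longrightarrow> p k \<noteq> 0"
  using A_rec[OF assms] by blast

text \<open>The recurrence for \<open>A (j - 1)\<close> can be solved for \<open>A j\<close>, whose
  coefficient is nonzero. So every \<open>A j\<close> is a polynomial in \<open>A 1\<close>, and
  invariance need only be checked for \<open>A 1\<close>.\<close>

lemma subspace_closed_A:
  assumes "subspace S" "\<And>w. w \<in> S \<Longrightarrow> A 1 w \<in> S" "j \<le> D" "w \<in> S"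
  shows "A j w \<in> S"
  using assms(3,4)
proof (induction j arbitrary: w rule: less_induct)
  case (less j)
  show ?case
  proof (cases j)
    case 0
    then show ?thesis using less A_0 by simp
  next
    case (Suc m)
    then have "m \<le> D" using less by simp
    from A_recE[OF this] obtain p
      where p: "\<And>v. A 1 (A m v) = (\<Sum>k\<le>D. scale (p k) (A k v))"
        and p0: "\<And>k. k \<le> D \<Longrightarrow> k + 1 < m \<or> m + 1 < k \<Longrightarrow> p k = 0"
        and p1: "\<And>k. k \<le> D \<Longrightarrow> k + 1 = m \<or> k = m + 1 \<Longrightarrow> p k \<noteq> 0" by blast
    have pj: "p j \<noteq> 0" using p1[of j] Suc less.prems by simp
    have "(\<Sum>k\<le>D. scale (p k) (A k w)) = (\<Sum>k\<le>j. scale (p k) (A k w))"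
      using less.prems Suc p0 by (intro sum.mono_neutral_right) auto
    then have eq: "scale (p j) (A j w) = A 1 (A m w) - (\<Sum>k<j. scale (p k) (A k w))"
      using p[of w] by (simp add: lessThan_Suc_atMost[symmetric])
    have "A 1 (A m w) \<in> S" using less Suc assms(2) by auto
    moreover have "(\<Sum>k<j. scale (p k) (A k w)) \<in> S"
      using less by (intro subspace_sum subspace_scale assms(1)) auto
    ultimately have "scale (p j) (A j w) \<in> S"
      unfolding eq by (intro subspace_diff assms(1))
    then have "scale (inverse (p j)) (scale (p j) (A j w)) \<in> S"
      by (rule subspace_scale[OF assms(1)])
    then show ?thesis using pj by simp
  qed
qed

text \<open>The recurrence run downwards: once \<open>A j w = 0\<close> for all
  \<open>j > m\<close>, the recurrence for \<open>A (m + 1)\<close> leaves only the term in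
  \<open>A m w\<close>, with a nonzero coefficient. The descent ends at
  \<open>A 0 w = w\<close>.\<close>

lemma A_top_vanishing:
  assumes "m < D" "\<And>j. m < j \<Longrightarrow> j \<le> D \<Longrightarrow> A j w = 0"
  shows "w = 0"
  using assms
proof (induction m)
  case 0
  from A_recE[OF D_pos] obtain p
    where p: "\<And>v. A 1 (A 1 v) = (\<Sum>k\<le>D. scale (p k) (A k v))"
      and "\<And>k. k \<le> D \<Longrightarrow> k + 1 < 1 \<or> 1 + 1 < k \<Longrightarrow> p k = 0"
      and p1: "\<And>k. k \<le> D \<Longrightarrow> k + 1 = 1 \<or> k = 1 + 1 \<Longrightarrow> p k \<noteq> 0" by blast
  have p0: "p 0 \<noteq> 0" using p1[of 0] by simp
  have "(\<Sum>k\<le>D. scale (p k) (A k w)) = (\<Sum>k\<in>{0}. scale (p k) (A k w))"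
    using 0(2) by (intro sum.mono_neutral_right) auto
  moreover have "A 1 (A 1 w) = 0"
    using 0(2)[of 1] D_pos module_hom.zero[OF hom_A1] by simp
  ultimately show ?case using p[of w] p0 A_0 by simp
next
  case (Suc m)
  have *: "A (Suc m) w = 0"
  proof -
    let ?j = "Suc (Suc m)"
    have "?j \<le> D" using Suc by simp
    from A_recE[OF this] obtain p
      where p: "\<And>v. A 1 (A ?j v) = (\<Sum>k\<le>D. scale (p k) (A k v))"
        and p0: "\<And>k. k \<le> D \<Longrightarrow> k + 1 < ?j \<or> ?j + 1 < k \<Longrightarrow> p k = 0"
        and p1: "\<And>k. k \<le> D \<Longrightarrow> k + 1 = ?j \<or> k = ?j + 1 \<Longrightarrow> p k \<noteq> 0" by blast
    have pm: "p (Suc m) \<noteq> 0" using p1[of "Suc m"] Suc.prems(1) by simp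
    have "(\<Sum>k\<le>D. scale (p k) (A k w)) = (\<Sum>k\<in>{Suc m}. scale (p k) (A k w))"
    proof (intro sum.mono_neutral_right ballI)
      fix k assume k: "k \<in> {..D} - {Suc m}"
      show "scale (p k) (A k w) = 0"
        using k Suc.prems(2)[of k] p0[of k] by (cases "k \<le> m") auto
    qed (use Suc.prems in auto)
    moreover have "A 1 (A ?j w) = 0"
      using Suc.prems(2)[OF _ \<open>?j \<le> D\<close>] module_hom.zero[OF hom_A1] by simp
    ultimately show ?thesis using p[of w] pm by simp
  qed
  show ?case
  proof (rule Suc.IH)
    show "A j w = 0" if "m < j" "j \<le> D" for j
      using that * Suc.prems(2)[of j] by (cases "j = Suc m") auto
  qed (use Suc.prems in simp)
qed

end

locale pq_action =
  polynomial_action scale D A E Es + dual: polynomial_action scale D As Es E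
  for scale :: "'a::field \<Rightarrow> 'v::ab_group_add \<Rightarrow> 'v" and D A E As Es
begin

text \<open>Source of the dual statements below: a lemma of this locale is applied to the swapped
  data through \<open>OF dual_action\<close>, and \<open>dual_invariant\<close>,
  \<open>dual_irreducible\<close> and \<open>dual_corner\<close> translate the swapped notions
  back.\<close>

lemma dual_action: "pq_action scale D As Es A E"
  by (intro pq_action.intro polynomial_action_axioms dual.polynomial_action_axioms)

section \<open>Invariant subspaces and their supports\<close>

definition invariant :: "'v set \<Rightarrow> bool" where
  "invariant W \<longleftrightarrow> subspace W \<and> (\<forall>i\<le>D. \<forall>w\<in>W. A i w \<in> W \<and> As i w \<in> W)"

definition irreducible_sub :: "'v set \<Rightarrow> bool" where
  "irreducible_sub W \<longleftrightarrow> invariant W \<and> W \<noteq> {0} \<and>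
     (\<forall>U. invariant U \<longrightarrow> U \<subseteq> W \<longrightarrow> U = {0} \<or> U = W)"

definition supp :: "'v set \<Rightarrow> nat set" where
  "supp W = {i. i \<le> D \<and> (\<exists>w\<in>W. Es i w \<noteq> 0)}"

definition thin_sub :: "'v set \<Rightarrow> bool" where
  "thin_sub W \<longleftrightarrow> (\<forall>i\<le>D. \<exists>u. \<forall>w\<in>W. \<exists>c. Es i w = scale c u)"

lemma dual_invariant: "pq_action.invariant scale D As A = invariant"
  unfolding fun_eq_iff pq_action.invariant_def[OF dual_action] invariant_def by blast

lemma dual_irreducible: "pq_action.irreducible_sub scale D As A = irreducible_sub"
  unfolding fun_eq_iff pq_action.irreducible_sub_def[OF dual_action] irreducible_sub_def
    dual_invariant by blast

lemma invariantI:
  assumes "subspace W" "\<And>w. w \<in> W \<Longrightarrow> A 1 w \<in> W" "\<And>w. w \<in> W \<Longrightarrow> As 1 w \<in> W"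
  shows "invariant W"
  using assms subspace_closed_A dual.subspace_closed_A unfolding invariant_def by blast

lemma invariantD:
  assumes "invariant W"
  shows "subspace W" "i \<le> D \<Longrightarrow> w \<in> W \<Longrightarrow> A i w \<in> W" "i \<le> D \<Longrightarrow> w \<in> W \<Longrightarrow> As i w \<in> W"
  using assms unfolding invariant_def by auto

lemma invariant_E: 
  assumes "invariant W" "j \<le> D" "w \<in> W"
  shows "E j w \<in> W"
proof -
  obtain c where "E j w = (\<Sum>i\<le>D. scale (c i) (A i w))" using E_span[OF assms(2)] by blast
  then show ?thesis using assms invariantD[OF assms(1)]
    by (auto intro!: subspace_sum subspace_scale)
qed

lemma invariant_Es: "invariant W \<Longrightarrow> j \<le> D \<Longrightarrow> w \<in> W \<Longrightarrow> Es j w \<in> W"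
  using pq_action.invariant_E[OF dual_action] unfolding dual_invariant by blast

text \<open>By \<open>Es_A_Es\<close>, \<open>A 1\<close> moves a component by at most one step, so
  only \<open>h\<close> and its neighbours can contribute.\<close>

lemma Es_A1_eq_0:
  assumes "h \<le> D"
    and "\<And>k. k \<le> D \<Longrightarrow> k \<le> h + 1 \<Longrightarrow> h \<le> k + 1 \<Longrightarrow> Es h (A 1 (Es k v)) = 0"
  shows "Es h (A 1 v) = 0"
proof -
  have "Es h (A 1 v) = Es h (A 1 (\<Sum>k\<le>D. Es k v))" by (simp add: dual.E_sum)
  also have "\<dots> = (\<Sum>k\<le>D. Es h (A 1 (Es k v)))"
    by (simp add: module_hom.sum[OF hom_A1] module_hom.sum[OF dual.hom_E[OF assms(1)]])
  also have "\<dots> = 0"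
  proof (rule sum.neutral, rule ballI)
    fix k assume "k \<in> {..D}"
    then have "k \<le> D" by simp
    show "Es h (A 1 (Es k v)) = 0"
    proof (cases "k \<le> h + 1 \<and> h \<le> k + 1")
      case True
      then show ?thesis using assms \<open>k \<le> D\<close> by blast
    next
      case False
      then show ?thesis using Es_A_Es[OF assms(1) D_pos \<open>k \<le> D\<close>] by auto
    qed
  qed
  finally show ?thesis .
qed

lemma Es_A1_Es_0: "h \<le> D \<Longrightarrow> Es k v = 0 \<Longrightarrow> Es h (A 1 (Es k v)) = 0"
  using module_hom.zero[OF hom_A1] module_hom.zero[OF dual.hom_E[of h]] by simp

lemma Es_As1_eq_0: "h \<le> D \<Longrightarrow> Es h v = 0 \<Longrightarrow> Es h (As 1 v) = 0"
  using dual.E_A1[of h v] by simp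

lemma subspace_kernels:
  assumes "subspace W" "\<And>k. k \<in> K \<Longrightarrow> module_hom scale scale (f k)"
  shows "subspace {w \<in> W. \<forall>k\<in>K. f k w = 0}"
  using assms(1) assms(2)[THEN module_hom.add] assms(2)[THEN module_hom.scale]
    assms(2)[THEN module_hom.zero]
  unfolding subspace_def by auto

text \<open>\<open>As 1\<close> is scalar on each \<open>Es\<close>-component and respects every
  cut. \<open>A 1\<close> could leave the components below \<open>h\<close> only by the step from
  \<open>h - 1\<close> to \<open>h\<close>, which \<open>z\<close> forbids.\<close>

lemma upper_cut_invariant:
  assumes W: "invariant W" and h: "1 \<le> h" "h \<le> D"
    and z: "\<And>w. w \<in> W \<Longrightarrow> Es h (A 1 (Es (h - 1) w)) = 0"
  shows "invariant {w \<in> W. \<forall>k\<in>{h..D}. Es k w = 0}"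
proof (rule invariantI)
  show "subspace {w \<in> W. \<forall>k\<in>{h..D}. Es k w = 0}"
    by (intro subspace_kernels invariantD(1)[OF W] dual.hom_E) auto
next
  fix w assume w: "w \<in> {w \<in> W. \<forall>k\<in>{h..D}. Es k w = 0}"
  show "As 1 w \<in> {w \<in> W. \<forall>k\<in>{h..D}. Es k w = 0}"
    using w invariantD(3)[OF W D_pos] Es_As1_eq_0 by auto
  have "Es k (A 1 w) = 0" if k: "k \<in> {h..D}" for k
  proof (rule Es_A1_eq_0)
    fix l assume l: "l \<le> D" "l \<le> k + 1" "k \<le> l + 1"
    show "Es k (A 1 (Es l w)) = 0"
    proof (cases "h \<le> l")
      case True
      then show ?thesis using w k l by (intro Es_A1_Es_0) auto
    next
      case False
      then have "l = h - 1" "k = h" using k l by auto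
      then show ?thesis using z w by auto
    qed
  qed (use k in auto)
  then show "A 1 w \<in> {w \<in> W. \<forall>k\<in>{h..D}. Es k w = 0}"
    using w invariantD(2)[OF W D_pos] by auto
qed

text \<open>Mirror image of the upper cut: the only exit is the step from \<open>h\<close> to
  \<open>h - 1\<close>.\<close>

lemma lower_cut_invariant:
  assumes W: "invariant W" and h: "1 \<le> h" "h \<le> D"
    and z: "\<And>w. w \<in> W \<Longrightarrow> Es (h - 1) (A 1 (Es h w)) = 0"
  shows "invariant {w \<in> W. \<forall>k\<in>{..<h}. Es k w = 0}"
proof (rule invariantI)
  show "subspace {w \<in> W. \<forall>k\<in>{..<h}. Es k w = 0}"
    using h by (intro subspace_kernels invariantD(1)[OF W] dual.hom_E) auto
next
  fix w assume w: "w \<in> {w \<in> W. \<forall>k\<in>{..<h}. Es k w = 0}"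
  show "As 1 w \<in> {w \<in> W. \<forall>k\<in>{..<h}. Es k w = 0}"
    using w h invariantD(3)[OF W D_pos] Es_As1_eq_0 by auto
  have "Es k (A 1 w) = 0" if k: "k \<in> {..<h}" for k
  proof (rule Es_A1_eq_0)
    fix l assume l: "l \<le> D" "l \<le> k + 1" "k \<le> l + 1"
    show "Es k (A 1 (Es l w)) = 0"
    proof (cases "l < h")
      case True
      then show ?thesis using w k l h by (intro Es_A1_Es_0) auto
    next
      case False
      then have "k = h - 1" "l = h" using k l by auto
      then show ?thesis using z w by auto
    qed
  qed (use k h in auto)
  then show "A 1 w \<in> {w \<in> W. \<forall>k\<in>{..<h}. Es k w = 0}"
    using w invariantD(2)[OF W D_pos] by auto
qed

lemma irreducible_subD:
  assumes "irreducible_sub W"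
  shows "invariant W" "W \<noteq> {0}" "invariant U \<Longrightarrow> U \<subseteq> W \<Longrightarrow> u \<in> U \<Longrightarrow> u \<noteq> 0 \<Longrightarrow> U = W"
  using assms unfolding irreducible_sub_def by auto

lemma ex_nonzero: assumes "irreducible_sub W" shows "\<exists>w\<in>W. w \<noteq> 0"
  using irreducible_subD[OF assms] subspace_0[OF invariantD(1)] by blast

lemma finite_supp: "finite (supp W)"
  unfolding supp_def by simp

lemma supp_nonempty: assumes "irreducible_sub W" shows "supp W \<noteq> {}"
proof
  assume "supp W = {}"
  then have "\<And>w. w \<in> W \<Longrightarrow> (\<Sum>i\<le>D. Es i w) = 0" unfolding supp_def by (intro sum.neutral) auto
  then show False using ex_nonzero[OF assms] by (simp add: dual.E_sum)
qed

lemma Es_outside_supp: "w \<in> W \<Longrightarrow> i \<le> D \<Longrightarrow> i \<notin> supp W \<Longrightarrow> Es i w = 0"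
  unfolding supp_def by blast

text \<open>At a gap \<open>i\<close> the step from \<open>i - 1\<close> to \<open>i\<close>
  vanishes. The upper cut at \<open>i\<close> is then invariant; it contains the lowest component
  and misses the highest one, against irreducibility.\<close>

lemma supp_interval:
  assumes W: "irreducible_sub W"
  shows "supp W = {Min (supp W)..Max (supp W)}"
proof
  note inv = irreducible_subD(1)[OF W]
  note fin = finite_supp[of W] and ne = supp_nonempty[OF W]
  show "supp W \<subseteq> {Min (supp W)..Max (supp W)}" using fin by auto
  show "{Min (supp W)..Max (supp W)} \<subseteq> supp W"
  proof (rule subsetI, rule ccontr)
    fix i assume i: "i \<in> {Min (supp W)..Max (supp W)}" "i \<notin> supp W"
    have r: "Min (supp W) \<in> supp W" and s: "Max (supp W) \<in> supp W" using fin ne by auto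
    then have lt: "Min (supp W) < i" "i < Max (supp W)" using i by (auto simp: order_less_le)
    have sD: "Max (supp W) \<le> D" using s unfolding supp_def by blast
    have iD: "1 \<le> i" "i \<le> D" using lt sD by auto
    have U: "invariant {w \<in> W. \<forall>k\<in>{i..D}. Es k w = 0}"
    proof (rule upper_cut_invariant[OF inv iD])
      fix w assume "w \<in> W"
      then have "A 1 (Es (i - 1) w) \<in> W"
        using iD by (intro invariantD(2)[OF inv D_pos] invariant_Es[OF inv]) auto
      then show "Es i (A 1 (Es (i - 1) w)) = 0" using i iD Es_outside_supp by blast
    qed
    obtain w where w: "w \<in> W" "Es (Min (supp W)) w \<noteq> 0" using r unfolding supp_def by blast
    have "Es (Min (supp W)) w \<in> {w \<in> W. \<forall>k\<in>{i..D}. Es k w = 0}"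
      using w lt iD invariant_Es[OF inv] by (auto simp: dual.E_E)
    from irreducible_subD(3)[OF W U _ this w(2)]
    have "\<forall>k\<in>{i..D}. Es k w' = 0" if "w' \<in> W" for w' using that by blast
    moreover obtain w' where "w' \<in> W" "Es (Max (supp W)) w' \<noteq> 0"
      using s unfolding supp_def by blast
    ultimately show False using lt(2) sD by auto
  qed
qed

section \<open>Corners, which are the intersections of \<open>W\<close> with V(i, j), and the split
  decomposition\<close>

definition corner :: "'v set \<Rightarrow> nat \<Rightarrow> nat \<Rightarrow> 'v set" where
  "corner W i j = {w \<in> W. (\<forall>k\<le>D. i < k \<longrightarrow> Es k w = 0) \<and> (\<forall>l\<le>D. j < l \<longrightarrow> E l w = 0)}"

lemma dual_corner: "pq_action.corner D Es E W j i = corner W i j"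
  unfolding pq_action.corner_def[OF dual_action] corner_def by blast

text \<open>Subtracting the eigenvalue removes the component \<open>E j\<close>, while
  \<open>A 1\<close> extends the \<open>Es\<close>-range by at most one. The case
  \<open>j = 0\<close> is stated separately since there \<open>j - 1\<close> is truncated and no
  component is left.\<close>

lemma corner_raise:
  assumes W: "invariant W" and w: "w \<in> corner W i j" and j: "j \<le> D"
  shows "A 1 w - scale (eigval j) w \<in> corner W (i + 1) (j - 1)"
    "j = 0 \<Longrightarrow> A 1 w - scale (eigval j) w = 0"
proof -
  let ?z = "A 1 w - scale (eigval j) w"
  have wW: "w \<in> W" using w unfolding corner_def by blast
  have E: "E l ?z = scale (eigval l - eigval j) (E l w)" if "l \<le> D" for l
    using that by (simp add: module_hom.diff[OF hom_E] module_hom.scale[OF hom_E] E_A1 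
        scale_left_diff_distrib)
  have E0: "E l ?z = 0" if "l \<le> D" "j \<le> l" for l
    using that w E[OF that(1)] unfolding corner_def by (cases "l = j") auto
  have Es0: "Es k ?z = 0" if "k \<le> D" "i + 1 < k" for k
  proof -
    have "Es k (A 1 w) = 0"
      by (rule Es_A1_eq_0[OF that(1)], rule Es_A1_Es_0) (use w that in \<open>auto simp: corner_def\<close>)
    moreover have "Es k w = 0" using w that unfolding corner_def by auto
    ultimately show ?thesis using that
      by (simp add: module_hom.diff[OF dual.hom_E] module_hom.scale[OF dual.hom_E])
  qed
  have "?z \<in> W" using wW W D_pos
    by (intro subspace_diff subspace_scale invariantD(1,2)) auto
  then show "?z \<in> corner W (i + 1) (j - 1)" unfolding corner_def using E0 Es0 by auto
  show "?z = 0" if "j = 0"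
  proof -
    have "(\<Sum>l\<le>D. E l ?z) = 0" using E0 that by (intro sum.neutral) auto
    then show ?thesis by (simp only: E_sum)
  qed
qed

lemma corner_lower:
  assumes W: "invariant W" and w: "w \<in> corner W i j" and i: "i \<le> D"
  shows "As 1 w - scale (dual.eigval i) w \<in> corner W (i - 1) (j + 1)"
    "i = 0 \<Longrightarrow> As 1 w - scale (dual.eigval i) w = 0"
  by (rule pq_action.corner_raise[OF dual_action, unfolded dual_corner dual_invariant, OF assms];
      assumption)+


text \<open>The sum of the corners on the antidiagonal \<open>i + j = n\<close>; the bounds on
  \<open>i\<close> keep both indices in \<open>{0..D}\<close>.\<close>

definition corner_sum :: "'v set \<Rightarrow> nat \<Rightarrow> 'v set" where
  "corner_sum W n = span (\<Union>i\<in>{i. i \<le> D \<and> i \<le> n \<and> n \<le> i + D}. corner W i (n - i))"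

lemma corner_sum_base:
  "u \<in> corner W i j \<Longrightarrow> i \<le> D \<Longrightarrow> j \<le> D \<Longrightarrow> i + j = n \<Longrightarrow> u \<in> corner_sum W n"
  unfolding corner_sum_def by (force intro!: span_base)

text \<open>The operators \<open>A 1\<close> and \<open>As 1\<close> shift the corners with \<open>i + j\<close> fixed by one step in
  opposite directions, up to scalars.\<close>

lemma corner_sum_invariant:
  assumes W: "invariant W"
  shows "invariant (corner_sum W n)"
proof (rule invariantI)
  show sub: "subspace (corner_sum W n)" unfolding corner_sum_def by (rule subspace_span)
  fix w assume "w \<in> corner_sum W n"
  then have w: "w \<in> span (\<Union>i\<in>{i. i \<le> D \<and> i \<le> n \<and> n \<le> i + D}. corner W i (n - i))"
    unfolding corner_sum_def .
  show "A 1 w \<in> corner_sum W n"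
    using w
  proof (induction rule: span_induct_alt)
    case base
    then show ?case using module_hom.zero[OF hom_A1] subspace_0[OF sub] by simp
  next
    case (step c u v)
    then obtain i where i: "i \<le> D" "i \<le> n" "n \<le> i + D" and u: "u \<in> corner W i (n - i)" by auto
    let ?z = "A 1 u - scale (eigval (n - i)) u"
    have j: "n - i \<le> D" using i by auto
    have "?z \<in> corner_sum W n"
    proof (cases "n - i = 0")
      case True
      then show ?thesis using corner_raise(2)[OF W u j] subspace_0[OF sub] by simp
    next
      case False
      have z: "?z \<in> corner W (i + 1) (n - i - 1)" by (rule corner_raise(1)[OF W u j])
      show ?thesis
      proof (cases "i + 1 \<le> D")
        case True
        then show ?thesis using corner_sum_base[OF z] False j by simp
      next
        case iD: False
        then have "i = D" using i by simp
        \<comment> \<open>The first index cannot exceed \<open>D\<close>, but at \<open>D\<close>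
          its condition is void. So the raised vector still lies in the corner with the old
          indices.\<close>
        have "?z \<in> corner W D (n - i)"
          using z False \<open>i = D\<close> unfolding corner_def by auto
        then show ?thesis using j \<open>i = D\<close> i by (intro corner_sum_base[of _ W D "n - i"]) auto
      qed
    qed
    moreover have "u \<in> corner_sum W n"
      using corner_sum_base[OF u i(1) j] i by simp
    ultimately have "?z + scale (eigval (n - i)) u \<in> corner_sum W n"
      by (intro subspace_add[OF sub] subspace_scale[OF sub])
    then have "A 1 u \<in> corner_sum W n" by simp
    then show ?case using step
      by (simp add: module_hom.add[OF hom_A1] module_hom.scale[OF hom_A1]
          subspace_add[OF sub] subspace_scale[OF sub])
  qed
  show "As 1 w \<in> corner_sum W n"
    using w
  proof (induction rule: span_induct_alt)
    case base
    then show ?case using module_hom.zero[OF dual.hom_A1] subspace_0[OF sub] by simp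
  next
    case (step c u v)
    then obtain i where i: "i \<le> D" "i \<le> n" "n \<le> i + D" and u: "u \<in> corner W i (n - i)" by auto
    let ?z = "As 1 u - scale (dual.eigval i) u"
    have j: "n - i \<le> D" using i by auto
    have "?z \<in> corner_sum W n"
    proof (cases "i = 0")
      case True
      then show ?thesis using corner_lower(2)[OF W u i(1)] subspace_0[OF sub] by simp
    next
      case False
      have z: "?z \<in> corner W (i - 1) (n - i + 1)" by (rule corner_lower(1)[OF W u i(1)])
      show ?thesis
      proof (cases "n - i + 1 \<le> D")
        case True
        then show ?thesis using corner_sum_base[OF z] False i by simp
      next
        case jD: False
        then have "n - i = D" using j by simp
        have "?z \<in> corner W i D"
          using z False \<open>n - i = D\<close> unfolding corner_def by auto
        then show ?thesis using \<open>n - i = D\<close> i by (intro corner_sum_base[of _ W i D]) auto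
      qed
    qed
    moreover have "u \<in> corner_sum W n"
      using corner_sum_base[OF u i(1) j] i by simp
    ultimately have "?z + scale (dual.eigval i) u \<in> corner_sum W n"
      by (intro subspace_add[OF sub] subspace_scale[OF sub])
    then have "As 1 u \<in> corner_sum W n" by simp
    then show ?case using step
      by (simp add: module_hom.add[OF dual.hom_A1] module_hom.scale[OF dual.hom_A1]
          subspace_add[OF sub] subspace_scale[OF sub])
  qed
qed

section \<open>Inequalities between support and dual support\<close>

abbreviation dual_supp :: "'v set \<Rightarrow> nat set" where
  "dual_supp \<equiv> pq_action.supp D E"

lemma supp_le: "i \<in> supp W \<Longrightarrow> i \<le> D"
  unfolding supp_def by blast

lemma Min_supp: "irreducible_sub W \<Longrightarrow> Min (supp W) \<in> supp W"
  using finite_supp supp_nonempty by simp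

lemma Max_supp: "irreducible_sub W \<Longrightarrow> Max (supp W) \<in> supp W"
  using finite_supp supp_nonempty by simp

lemma Es_below_supp: 
  assumes "irreducible_sub W" "w \<in> W" "i \<le> D" "i < Min (supp W)"
  shows "Es i w = 0"
  using assms Es_outside_supp[OF assms(2,3)] finite_supp[of W] by (meson Min_le leD)

lemma Es_above_supp: 
  assumes "irreducible_sub W" "w \<in> W" "i \<le> D" "Max (supp W) < i"
  shows "Es i w = 0"
  using assms Es_outside_supp[OF assms(2,3)] finite_supp[of W] by (meson Max_ge leD)

lemma dual_irr: "irreducible_sub W \<Longrightarrow> pq_action.irreducible_sub scale D As A W"
  by (simp only: dual_irreducible)

lemmas E_above_supp = pq_action.Es_above_supp[OF dual_action dual_irr]
lemmas Min_dual_supp = pq_action.Min_supp[OF dual_action dual_irr]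
lemmas Max_dual_supp = pq_action.Max_supp[OF dual_action dual_irr]
lemmas dual_supp_le = pq_action.supp_le[OF dual_action]

text \<open>Components below \<open>Min (supp W)\<close> vanish because of the support, those above
  \<open>i\<close> because of the corner. If these ranges covered everything, \<open>w\<close> would
  be zero.\<close>

lemma corner_Min_le:
  assumes W: "irreducible_sub W" and w: "w \<in> corner W i j" "w \<noteq> 0"
  shows "Min (supp W) \<le> i"
proof (rule ccontr)
  assume "\<not> Min (supp W) \<le> i"
  then have "Es k w = 0" if "k \<le> D" for k
    using w that Es_below_supp[OF W, of w k] unfolding corner_def by (cases "k \<le> i") auto
  then have "(\<Sum>k\<le>D. Es k w) = 0" by simp
  then show False using w by (simp add: dual.E_sum)
qed

text \<open>Irreducibility makes the antidiagonal sum all of \<open>W\<close>, so some corner with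
  indices \<open>k\<close> and \<open>i + j - k\<close> has a nonzero component at
  \<open>Max (supp W)\<close>. That forces \<open>Max (supp W)\<close> to be at most
  \<open>k\<close>, and \<open>corner_Min_le\<close> in dual form bounds
  \<open>Min (dual_supp W)\<close> by \<open>i + j - k\<close>.\<close>

lemma corner_bound:
  assumes W: "irreducible_sub W" and w: "w \<in> corner W i j" "w \<noteq> 0" and ij: "i \<le> D" "j \<le> D"
  shows "Max (supp W) + Min (dual_supp W) \<le> i + j"
proof -
  note inv = irreducible_subD(1)[OF W]
  let ?n = "i + j" and ?s = "Max (supp W)" and ?q = "Min (dual_supp W)"
  have "w \<in> corner_sum W ?n" using corner_sum_base[OF w(1) ij] by simp
  moreover have "corner_sum W ?n \<subseteq> W" unfolding corner_sum_def
    by (rule span_minimal[OF _ invariantD(1)[OF inv]]) (auto simp: corner_def)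
  ultimately have eq: "corner_sum W ?n = W"
    using irreducible_subD(3)[OF W corner_sum_invariant[OF inv]] w by blast
  obtain v where v: "v \<in> W" "Es ?s v \<noteq> 0" using Max_supp[OF W] unfolding supp_def by blast
  have sD: "?s \<le> D" using Max_supp[OF W] supp_le by blast
  have "\<exists>k\<le>?n. \<exists>u\<in>corner W k (?n - k). Es ?s u \<noteq> 0"
  proof (rule ccontr)
    assume "\<not> ?thesis"
    then have "(\<Union>k\<in>{k. k \<le> D \<and> k \<le> ?n \<and> ?n \<le> k + D}. corner W k (?n - k)) \<subseteq> {u. Es ?s u = 0}"
      by auto
    moreover have "subspace {u. Es ?s u = 0}"
      using module_hom.subspace_kernel[OF dual.hom_E[OF sD]] by simp
    ultimately have "corner_sum W ?n \<subseteq> {u. Es ?s u = 0}"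
      unfolding corner_sum_def by (rule span_minimal)
    then show False using v eq by blast
  qed
  then obtain k u where k: "k \<le> ?n" "u \<in> corner W k (?n - k)" "Es ?s u \<noteq> 0" by blast
  then have "u \<noteq> 0" using module_hom.zero[OF dual.hom_E[OF sD]] by auto
  then have "?q \<le> ?n - k"
    using pq_action.corner_Min_le[OF dual_action dual_irr[OF W], unfolded dual_corner, OF k(2)]
    by simp
  moreover have "?s \<le> k"
  proof (rule ccontr)
    assume "\<not> ?s \<le> k"
    then have "Es ?s u = 0" using k(2) sD unfolding corner_def by auto
    then show False using k(3) by simp
  qed
  ultimately show ?thesis using k by linarith
qed

lemma corner_bound':
  assumes W: "irreducible_sub W" and w: "w \<in> corner W i j" "w \<noteq> 0" and ij: "i \<le> D" "j \<le> D"
  shows "Max (dual_supp W) + Min (supp W) \<le> i + j"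
  using pq_action.corner_bound[OF dual_action dual_irr[OF W], unfolded dual_corner, OF w ij(2,1)]
  by simp

text \<open>\<open>corner_bound\<close> applied to a nonzero lowest component, which lies in the
  corner given by \<open>Min (supp W)\<close> and \<open>Max (dual_supp W)\<close>.\<close>

lemma Max_supp_plus_Min_dual:
  assumes W: "irreducible_sub W"
  shows "Max (supp W) + Min (dual_supp W) \<le> Max (dual_supp W) + Min (supp W)"
proof -
  note inv = irreducible_subD(1)[OF W]
  let ?r = "Min (supp W)" and ?e = "Max (dual_supp W)"
  have rD: "?r \<le> D" and eD: "?e \<le> D"
    using Min_supp[OF W] supp_le Max_dual_supp[OF W] dual_supp_le by blast+
  obtain w where w: "w \<in> W" "Es ?r w \<noteq> 0" using Min_supp[OF W] unfolding supp_def by blast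
  have z: "Es ?r w \<in> W" using invariant_Es[OF inv rD w(1)] .
  have "Es ?r w \<in> corner W ?r ?e"
    using z rD E_above_supp[OF W z] unfolding corner_def by (auto simp: dual.E_E)
  from corner_bound[OF W this w(2) rD eD] show ?thesis by simp
qed

text \<open>Rearranged, this says that diameter and dual diameter agree.\<close>

lemma supp_lengths:
  assumes W: "irreducible_sub W"
  shows "Max (supp W) + Min (dual_supp W) = Max (dual_supp W) + Min (supp W)"
  using Max_supp_plus_Min_dual[OF W]
    pq_action.Max_supp_plus_Min_dual[OF dual_action dual_irr[OF W]] by simp

text \<open>Otherwise \<open>A D\<close> would annihilate the lowest component of the module.\<close>

lemma supp_reach:
  assumes W: "irreducible_sub W"
  shows "D \<le> Min (supp W) + Max (supp W)"
proof (rule ccontr)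
  note inv = irreducible_subD(1)[OF W]
  let ?r = "Min (supp W)" and ?s = "Max (supp W)"
  assume "\<not> ?thesis"
  then have lt: "?r + ?s < D" by simp
  have rD: "?r \<le> D" using lt by simp
  obtain w where w: "w \<in> W" "Es ?r w \<noteq> 0" using Min_supp[OF W] unfolding supp_def by blast
  have "A j (Es ?r w) = 0" if j: "?r + ?s < j" "j \<le> D" for j
  proof -
    have z: "A j (Es ?r w) \<in> W" by (intro invariantD(2)[OF inv] invariant_Es[OF inv] j rD w)
    have "Es k (A j (Es ?r w)) = 0" if "k \<le> D" for k
    proof (cases "?s < k")
      case True
      then show ?thesis using Es_above_supp[OF W z that] by simp
    next
      case False
      then show ?thesis using Es_A_Es[OF that j(2) rD] j by auto
    qed
    then have "(\<Sum>k\<le>D. Es k (A j (Es ?r w))) = 0" by simp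
    then show ?thesis by (simp only: dual.E_sum)
  qed
  from A_top_vanishing[OF lt this] w(2) show False by blast
qed

text \<open>With \<open>s\<close>, \<open>e\<close> the maxima and \<open>r\<close>,
  \<open>q\<close> the minima of support and dual support, \<open>s + q\<close> and
  \<open>e + r\<close> are at most \<open>D\<close>, while \<open>r + s\<close> and
  \<open>q + e\<close> are at least \<open>D\<close>. This leaves only \<open>q = r\<close> and
  \<open>s = e = D - r\<close>.\<close>

lemma corner_forces_supp:
  assumes W: "irreducible_sub W" and w: "w \<in> corner W i j" "w \<noteq> 0" and ij: "i + j = D"
  defines "r \<equiv> Min (supp W)"
  shows "Min (dual_supp W) = r" "supp W = {r..D - r}" "dual_supp W = {r..D - r}"
    "r \<le> i" "r \<le> j" "r \<le> D - r"
proof -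
  have "i \<le> D" "j \<le> D" using ij by auto
  note b = corner_bound[OF W w this] corner_bound'[OF W w this]
  note d = supp_reach[OF W] pq_action.supp_reach[OF dual_action dual_irr[OF W]]
  note l = supp_lengths[OF W]
  show 1: "Min (dual_supp W) = r" using b d l ij unfolding r_def by linarith
  have 2: "Max (supp W) = D - r" using b d l ij unfolding r_def by linarith
  have 3: "Max (dual_supp W) = D - r" using b d l ij unfolding r_def by linarith
  show "supp W = {r..D - r}" using supp_interval[OF W] 2 unfolding r_def by simp
  show "dual_supp W = {r..D - r}"
    using pq_action.supp_interval[OF dual_action dual_irr[OF W]] 1 3 by simp
  show "r \<le> i" using corner_Min_le[OF W w] unfolding r_def .
  show "r \<le> j" using pq_action.corner_Min_le[OF dual_action dual_irr[OF W], unfolded dual_corner, OF w]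
    1 by simp
  show "r \<le> D - r" using Min_le[OF finite_supp Max_supp[OF W]] unfolding 2 r_def[symmetric] .
qed

text \<open>The image of \<open>Es i\<close> on \<open>W\<close> is a line, so lowering that kills
  one nonzero vector of it kills all of it. The lower cut at \<open>i\<close> is then invariant,
  contains \<open>Es i w\<close> and misses the lowest component.\<close>

lemma thin_lowering:
  assumes W: "irreducible_sub W" and thin: "thin_sub W" and w: "w \<in> W"
    and i: "i \<le> D" "Min (supp W) < i" and z: "Es (i - 1) (A 1 (Es i w)) = 0"
  shows "Es i w = 0"
proof (rule ccontr)
  note inv = irreducible_subD(1)[OF W]
  assume nz: "Es i w \<noteq> 0"
  obtain u where u: "\<And>v. v \<in> W \<Longrightarrow> \<exists>c. Es i v = scale c u"
    using thin i unfolding thin_sub_def by blast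
  obtain c where c: "Es i w = scale c u" using u w by blast
  then have c0: "c \<noteq> 0" using nz by auto
  have i1: "i - 1 \<le> D" "1 \<le> i" using i by auto
  have "Es (i - 1) (A 1 (Es i v)) = 0" if "v \<in> W" for v
  proof -
    obtain c' where "Es i v = scale c' u" using u \<open>v \<in> W\<close> by blast
    then have "Es i v = scale (c' / c) (Es i w)" using c c0 by simp
    then show ?thesis using z
      by (simp add: module_hom.scale[OF hom_A1] module_hom.scale[OF dual.hom_E[OF i1(1)]])
  qed
  from lower_cut_invariant[OF inv i1(2) i(1) this]
  have U: "invariant {w \<in> W. \<forall>k\<in>{..<i}. Es k w = 0}" .
  have "Es i w \<in> {w \<in> W. \<forall>k\<in>{..<i}. Es k w = 0}"
    using i w invariant_Es[OF inv] by (auto simp: dual.E_E)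
  from irreducible_subD(3)[OF W U _ this nz] have "\<And>v. v \<in> W \<Longrightarrow> Es (Min (supp W)) v = 0"
    using i by blast
  then show False using Min_supp[OF W] unfolding supp_def by blast
qed

text \<open>A thin irreducible module is generated by the \<open>A i\<close> from its lowest
  component, so each \<open>E j\<close> has rank at most one on it.\<close>

lemma thin_imp_dual_thin:
  assumes W: "irreducible_sub W" and thin: "thin_sub W"
  shows "pq_action.thin_sub scale D E W"
proof -
  note inv = irreducible_subD(1)[OF W]
  let ?r = "Min (supp W)"
  have rD: "?r \<le> D" using Min_supp[OF W] supp_le by blast
  obtain w1 where w1: "w1 \<in> W" "Es ?r w1 \<noteq> 0" using Min_supp[OF W] unfolding supp_def by blast
  define w0 where "w0 = Es ?r w1"
  have w0: "w0 \<in> W" "w0 \<noteq> 0" using invariant_Es[OF inv rD w1(1)] w1(2) unfolding w0_def by auto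
  \<comment> \<open>\<open>B\<close> contains \<open>w0\<close> and is closed under
    \<open>A 1\<close>, which acts on each \<open>E j\<close>-component by a scalar. Showing that
    \<open>W\<close> lies in \<open>B\<close> is exactly dual thinness, with the spanning vectors
    \<open>E j w0\<close>.\<close>
  define B where "B = {b. \<forall>j\<le>D. \<exists>c. E j b = scale c (E j w0)}"
  have B0: "0 \<in> B" unfolding B_def 
    by (auto simp: module_hom.zero[OF hom_E] intro!: exI[of _ 0])
  have Badd: "a + b \<in> B" if ab: "a \<in> B" "b \<in> B" for a b
    unfolding B_def
  proof (clarify)
    fix j assume j: "j \<le> D"
    obtain c c' where "E j a = scale c (E j w0)" "E j b = scale c' (E j w0)"
      using ab j unfolding B_def by blast
    then show "\<exists>c. E j (a + b) = scale c (E j w0)"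
      by (auto simp: module_hom.add[OF hom_E[OF j]] scale_left_distrib intro!: exI[of _ "c + c'"])
  qed
  have Bscale: "scale c b \<in> B" if b: "b \<in> B" for c b
    unfolding B_def
  proof (clarify)
    fix j assume j: "j \<le> D"
    obtain c' where "E j b = scale c' (E j w0)" using b j unfolding B_def by blast
    then show "\<exists>d. E j (scale c b) = scale d (E j w0)"
      by (auto simp: module_hom.scale[OF hom_E[OF j]] intro!: exI[of _ "c * c'"])
  qed
  have Bsub: "subspace B" using B0 Badd Bscale unfolding subspace_def by blast
  have BA: "A 1 b \<in> B" if "b \<in> B" for b
    using that Bscale unfolding B_def
    by (auto simp: E_A1)
  have w0B: "w0 \<in> B" unfolding B_def by (auto intro!: exI[of _ 1])
  \<comment> \<open>By thinness a single nonzero vector of the \<open>i\<close>-th component in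
    \<open>B\<close> brings the whole component into \<open>B\<close>.\<close>
  have span1: "Es i v \<in> B" if iv: "i \<le> D" "y \<in> W" "Es i y \<in> B" "Es i y \<noteq> 0" "v \<in> W" for i v y
  proof -
    obtain u where u: "\<And>v. v \<in> W \<Longrightarrow> \<exists>c. Es i v = scale c u"
      using thin iv(1) unfolding thin_sub_def by blast
    obtain c c' where c: "Es i y = scale c u" "Es i v = scale c' u" using u iv by blast
    then have "c \<noteq> 0" using iv by auto
    then have "Es i v = scale (c' / c) (Es i y)" using c by simp
    then show ?thesis using Bscale that by simp
  qed
  have EsB: "Es h w \<in> B" if "h \<le> D" "w \<in> W" for h w
    using that
  proof (induction h arbitrary: w rule: less_induct)
    case (less h)
    consider "h < ?r" | "h = ?r" | "?r < h" by linarith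
    then show ?case
    proof cases
      case 1
      then show ?thesis using Es_below_supp[OF W less.prems(2,1)] B0 by simp
    next
      case 2
      then show ?thesis using span1[OF rD w1(1)] w1(2) w0B less.prems unfolding w0_def by blast
    next
      case 3
      have h1: "1 \<le> h" "h - 1 < h" "h - 1 \<le> D" using 3 less.prems by auto
      show ?thesis
      \<comment> \<open>If raising from \<open>h - 1\<close> to \<open>h\<close> is nonzero,
        subtracting the lower components, in \<open>B\<close> by induction, leaves a nonzero vector
        of component \<open>h\<close> in \<open>B\<close>. If it is zero, the upper cut at
        \<open>h\<close> contains \<open>w0\<close> and hence is \<open>W\<close>, so component
        \<open>h\<close> is zero.\<close>
      proof (cases "\<exists>u\<in>W. Es h (A 1 (Es (h - 1) u)) \<noteq> 0")
        case True
        then obtain u where u: "u \<in> W" "Es h (A 1 (Es (h - 1) u)) \<noteq> 0" by blast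
        let ?y = "A 1 (Es (h - 1) u)"
        have y: "?y \<in> W" by (intro invariantD(2)[OF inv] invariant_Es[OF inv] D_pos h1 u)
        have yB: "?y \<in> B" by (intro BA less.IH h1 u)
        have high: "Es k ?y = 0" if "k \<le> D" "h < k" for k
          using that h1 by (intro Es_A_Es D_pos) auto
        have "?y = (\<Sum>k\<le>D. Es k ?y)" by (simp add: dual.E_sum)
        also have "\<dots> = (\<Sum>k\<le>h. Es k ?y)"
          using less.prems(1) high by (intro sum.mono_neutral_right) auto
        also have "\<dots> = (\<Sum>k<h. Es k ?y) + Es h ?y"
          by (simp add: lessThan_Suc_atMost[symmetric])
        finally have "Es h ?y = ?y - (\<Sum>k<h. Es k ?y)" by (simp add: algebra_simps)
        moreover have "(\<Sum>k<h. Es k ?y) \<in> B"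
          using less.IH[OF _ _ y] less.prems(1) by (intro subspace_sum[OF Bsub]) auto
        ultimately have "Es h ?y \<in> B" using subspace_diff[OF Bsub yB] by simp
        from span1[OF less.prems(1) y this u(2) less.prems(2)] show ?thesis .
      next
        case False
        then have "\<And>u. u \<in> W \<Longrightarrow> Es h (A 1 (Es (h - 1) u)) = 0" by blast
        from upper_cut_invariant[OF inv h1(1) less.prems(1) this]
        have U: "invariant {w \<in> W. \<forall>k\<in>{h..D}. Es k w = 0}" .
        have "w0 \<in> {w \<in> W. \<forall>k\<in>{h..D}. Es k w = 0}"
          using w0 3 rD unfolding w0_def by (auto simp: dual.E_E)
        from irreducible_subD(3)[OF W U _ this w0(2)] have "w \<in> {w \<in> W. \<forall>k\<in>{h..D}. Es k w = 0}"
          using less.prems(2) by simp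
        then have "Es h w = 0" using less.prems(1) by simp
        then show ?thesis using B0 by simp
      qed
    qed
  qed
  have "w \<in> B" if "w \<in> W" for w
  proof -
    have "(\<Sum>h\<le>D. Es h w) \<in> B" using EsB that by (intro subspace_sum[OF Bsub]) auto
    then show ?thesis by (simp only: dual.E_sum)
  qed
  then show ?thesis
    unfolding pq_action.thin_sub_def[OF dual_action] B_def by blast
qed

text \<open>The annihilating polynomial is taken one linear factor at a time:
  \<open>A 1 - eigval j\<close> removes \<open>j\<close> from \<open>S\<close> and shortens the
  range of vanishing \<open>Es\<close>-components by one, so the hypothesis passes to
  \<open>S\<close>.\<close>

lemma thin_vanishing:
  assumes W: "irreducible_sub W" and thin: "thin_sub W" and "finite S" "\<psi> \<in> W"
    and "\<And>l. l \<le> D \<Longrightarrow> l \<notin> S \<Longrightarrow> E l \<psi> = 0"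
    and "\<And>h. h \<le> D \<Longrightarrow> h < Min (supp W) + card S \<Longrightarrow> Es h \<psi> = 0"
  shows "\<psi> = 0"
  using assms(3-6)
proof (induction S arbitrary: \<psi> rule: finite_induct)
  case empty
  then have "(\<Sum>l\<le>D. E l \<psi>) = 0" by simp
  then show ?case by (simp only: E_sum)
next
  case (insert j S)
  note inv = irreducible_subD(1)[OF W]
  let ?r = "Min (supp W)"
  show ?case
  proof (cases "j \<le> D")
    case False
    show ?thesis
    proof (rule insert.IH)
      show "E l \<psi> = 0" if "l \<le> D" "l \<notin> S" for l
        using insert.prems(2)[of l] that False by auto
      show "Es h \<psi> = 0" if "h \<le> D" "h < ?r + card S" for h
        using insert.prems(3)[of h] that insert.hyps by auto
    qed (fact insert.prems)
  next
    case j: True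
    let ?p = "A 1 \<psi> - scale (eigval j) \<psi>"
    have "?p = 0"
    proof (rule insert.IH)
      show "?p \<in> W" using insert.prems(1) inv D_pos
        by (intro subspace_diff subspace_scale invariantD(1,2)) auto
      show "E l ?p = 0" if "l \<le> D" "l \<notin> S" for l
      proof -
        have "E l ?p = scale (eigval l - eigval j) (E l \<psi>)"
          using that by (simp add: module_hom.diff[OF hom_E] module_hom.scale[OF hom_E] E_A1
            scale_left_diff_distrib)
        then show ?thesis using that insert.prems(2)[of l] by (cases "l = j") auto
      qed
      show "Es h ?p = 0" if h: "h \<le> D" "h < ?r + card S" for h
      proof -
        have "Es h (A 1 \<psi>) = 0"
          by (rule Es_A1_eq_0[OF h(1)], rule Es_A1_Es_0[OF h(1)], rule insert.prems(3))
            (use h insert.hyps in auto)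
        moreover have "Es h \<psi> = 0" using insert.prems(3)[OF h(1)] h insert.hyps by simp
        ultimately show ?thesis using h
          by (simp add: module_hom.diff[OF dual.hom_E] module_hom.scale[OF dual.hom_E])
      qed
    qed
    then have eig: "A 1 \<psi> = scale (eigval j) \<psi>" by simp
    \<comment> \<open>Read the eigenvector equation at index \<open>h - 1\<close>: smaller
      components vanish by induction, those above \<open>h\<close> are out of reach, so lowering
      kills \<open>Es h \<psi>\<close> and \<open>thin_lowering\<close> applies.\<close>
    have "Es h \<psi> = 0" if "h \<le> D" for h
      using that
    proof (induction h rule: less_induct)
      case (less h)
      show ?case
      proof (cases "?r < h")
        case True
        have h1: "h - 1 \<le> D" "h - 1 < h" using less.prems True by auto
        have "Es (h - 1) (A 1 \<psi>) = Es (h - 1) (A 1 (\<Sum>k\<le>D. Es k \<psi>))"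
          by (simp add: dual.E_sum)
        also have "\<dots> = (\<Sum>k\<le>D. Es (h - 1) (A 1 (Es k \<psi>)))"
          by (simp add: module_hom.sum[OF hom_A1] module_hom.sum[OF dual.hom_E[OF h1(1)]])
        also have "\<dots> = (\<Sum>k\<in>{h}. Es (h - 1) (A 1 (Es k \<psi>)))"
        proof (intro sum.mono_neutral_right ballI)
          fix k assume k: "k \<in> {..D} - {h}"
          show "Es (h - 1) (A 1 (Es k \<psi>)) = 0"
          proof (cases "k < h")
            case True
            then show ?thesis using less.IH[of k] k by (intro Es_A1_Es_0[OF h1(1)]) auto
          next
            case False
            then show ?thesis using k h1 by (intro Es_A_Es D_pos) auto
          qed
        qed (use less.prems in auto)
        finally have "Es (h - 1) (A 1 \<psi>) = Es (h - 1) (A 1 (Es h \<psi>))" by simp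
        moreover have "Es (h - 1) (A 1 \<psi>) = 0"
          using less.IH[OF h1(2,1)] by (simp add: eig module_hom.scale[OF dual.hom_E[OF h1(1)]])
        ultimately have "Es (h - 1) (A 1 (Es h \<psi>)) = 0" by simp
        from thin_lowering[OF W thin insert.prems(1) less.prems True this] show ?thesis .
      next
        case False
        \<comment> \<open>The bound is strict and \<open>insert j S\<close> has at least one
          element, so the index \<open>h = Min (supp W)\<close> is covered as well.\<close>
        then show ?thesis using insert.prems(3)[OF less.prems] insert.hyps by simp
      qed
    qed
    then have "(\<Sum>h\<le>D. Es h \<psi>) = 0" by simp
    then show ?thesis by (simp only: dual.E_sum)
  qed
qed

end

section \<open>Metric and cometric association schemes\<close>

definition cscale :: "complex \<Rightarrow> 'x cvec \<Rightarrow> 'x cvec" where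
  "cscale c v = (\<lambda>y. c * v y)"

lemma sum_fun_apply: "(\<Sum>i\<in>I. f i) y = (\<Sum>i\<in>I. (f i :: 'x \<Rightarrow> 'a::comm_monoid_add) y)"
  by (induction I rule: infinite_finite_induct) auto

lemma zvec_0: "zvec = 0"
  by (simp add: zvec_def zero_fun_def)

lemma vector_space_cscale: "vector_space (cscale :: complex \<Rightarrow> 'x cvec \<Rightarrow> 'x cvec)"
  by unfold_locales (auto simp: cscale_def fun_eq_iff algebra_simps)

lemma subspace_cscale: "module.subspace cscale W \<longleftrightarrow> csubspace W"
proof -
  interpret vector_space "cscale :: complex \<Rightarrow> 'a cvec \<Rightarrow> 'a cvec" by (rule vector_space_cscale)
  show ?thesis
    unfolding subspace_def csubspace_def cscale_def zvec_def
    by (auto simp: plus_fun_def zero_fun_def)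
qed

lemma mapply_add: "mapply M (u + v) = mapply M u + mapply M v"
  by (auto simp: mapply_def fun_eq_iff sum.distrib algebra_simps)

lemma mapply_scale: "mapply M (cscale c v) = cscale c (mapply M v)"
  by (auto simp: mapply_def cscale_def fun_eq_iff sum_distrib_left mult_ac)

lemma module_hom_mapply: "module_hom cscale cscale (mapply M)"
proof -
  interpret vector_space "cscale :: complex \<Rightarrow> 'a cvec \<Rightarrow> 'a cvec" by (rule vector_space_cscale)
  show ?thesis by unfold_locales (auto simp: mapply_add mapply_scale)
qed

lemma mapply_mmult: "mapply (mmult A B) v = mapply A (mapply B v)"
proof
  fix y
  have "mapply (mmult A B) v y = (\<Sum>z\<in>UNIV. \<Sum>w\<in>UNIV. A y w * B w z * v z)"
    by (simp add: mapply_def mmult_def sum_distrib_right)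
  also have "\<dots> = (\<Sum>w\<in>UNIV. \<Sum>z\<in>UNIV. A y w * B w z * v z)" by (rule sum.swap)
  also have "\<dots> = mapply A (mapply B v) y"
    by (simp add: mapply_def sum_distrib_left mult.assoc)
  finally show "mapply (mmult A B) v y = mapply A (mapply B v) y" .
qed

lemma mapply_sum_mat: "mapply (\<lambda>y z. \<Sum>i\<in>I. c i * M i y z) v = (\<Sum>i\<in>I. cscale (c i) (mapply (M i) v))"
proof
  fix y
  have "mapply (\<lambda>y z. \<Sum>i\<in>I. c i * M i y z) v y = (\<Sum>z\<in>UNIV. \<Sum>i\<in>I. c i * M i y z * v z)"
    by (simp add: mapply_def sum_distrib_right)
  also have "\<dots> = (\<Sum>i\<in>I. \<Sum>z\<in>UNIV. c i * M i y z * v z)" by (rule sum.swap)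
  also have "\<dots> = (\<Sum>i\<in>I. cscale (c i) (mapply (M i) v)) y"
    by (simp add: sum_fun_apply cscale_def mapply_def sum_distrib_left mult.assoc)
  finally show "mapply (\<lambda>y z. \<Sum>i\<in>I. c i * M i y z) v y = (\<Sum>i\<in>I. cscale (c i) (mapply (M i) v)) y" .
qed

lemma mapply_diag: "mapply (\<lambda>y z. if y = z then d y else 0) v y = d y * v y"
proof -
  have "mapply (\<lambda>y z. if y = z then d y else 0) v y = (\<Sum>w\<in>UNIV. if y = w then d y * v w else 0)"
    unfolding mapply_def by (rule sum.cong) auto
  then show ?thesis by simp
qed

lemma mapply_idm: "mapply idm v = v"
  using mapply_diag[of "\<lambda>_. 1" v] by (auto simp: idm_def fun_eq_iff)

lemma sum_nat_delta: "(\<Sum>i\<le>D. b i * (if r = i then 1 else 0)) = b r" if "r \<le> D" for b :: "nat \<Rightarrow> complex"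
proof -
  have "(\<Sum>i\<le>D. b i * (if r = i then 1 else 0)) = (\<Sum>i\<le>D. if i = r then b i else 0)"
    by (rule sum.cong) auto
  then show ?thesis using that by simp
qed

lemma lagrange_interpolation:
  fixes q b :: "nat \<Rightarrow> 'a::field"
  assumes "inj_on q {..n}"
  shows "\<exists>f. degree f \<le> n \<and> (\<forall>i\<le>n. poly f (q i) = b i)"
proof -
  let ?l = "\<lambda>i. \<Prod>k\<in>{..n} - {i}. [:- q k, 1:]"
  let ?f = "\<Sum>i\<le>n. smult (b i / poly (?l i) (q i)) (?l i)"
  have nz: "poly (?l i) (q i) \<noteq> 0" if "i \<le> n" for i
    using that assms by (auto simp: poly_prod inj_on_def)
  have z: "poly (?l i) (q j) = 0" if "j \<le> n" "j \<noteq> i" for i j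
    using that by (auto simp: poly_prod intro!: prod_zero)
  have "degree (?l i) \<le> n" if "i \<le> n" for i
    using that by (simp add: degree_prod_eq_sum_degree)
  then have "degree ?f \<le> n"
    by (intro degree_sum_le) (auto intro: order.trans[OF degree_smult_le])
  moreover have "poly ?f (q j) = b j" if "j \<le> n" for j
  proof -
    have "poly ?f (q j) = (\<Sum>i\<le>n. b i / poly (?l i) (q i) * poly (?l i) (q j))"
      by (simp add: poly_sum)
    also have "\<dots> = (\<Sum>i\<in>{j}. b i / poly (?l i) (q i) * poly (?l i) (q j))"
      using that z by (intro sum.mono_neutral_right) auto
    finally show ?thesis using nz[OF that] by simp
  qed
  ultimately show ?thesis by blast
qed

lemma sum_swap3:
  "(\<Sum>z\<in>A. \<Sum>u\<in>B. \<Sum>v\<in>C. f z u v) = (\<Sum>u\<in>B. \<Sum>v\<in>C. \<Sum>z\<in>A. f z u v)"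
  by (subst sum.swap) (intro sum.cong refl sum.swap)

text \<open>\<open>D_pos\<close> makes index 1 denote an actual relation and idempotent; in the
  theorem it comes from the range of \<open>t\<close>.\<close>

locale pq_scheme =
  fixes R :: "'x::finite \<Rightarrow> 'x \<Rightarrow> nat" and D :: nat and E :: "nat \<Rightarrow> 'x cmat"
  assumes scheme: "sym_assoc_scheme R D"
    and idem: "prim_idempotents R D E"
    and met: "metric R"
    and comet: "cometric D E"
    and D_pos: "1 \<le> D"
begin

section \<open>The Bose-Mesner algebra as functions of the relation index\<close>

lemma R_le: "R y z \<le> D" and R_0: "R y z = 0 \<longleftrightarrow> y = z" and R_sym: "R y z = R z y"
  and R_surj: "i \<le> D \<Longrightarrow> \<exists>y z. R y z = i"
proof -
  note s = scheme[unfolded sym_assoc_scheme_def]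
  show "R y z \<le> D" using conjunct1[OF s] by simp
  show "R y z = 0 \<longleftrightarrow> y = z" using conjunct1[OF conjunct2[OF s]] by simp
  show "R y z = R z y" using conjunct1[OF conjunct2[OF conjunct2[OF s]]] by blast
  show "\<exists>y z. R y z = i" if "i \<le> D"
    using conjunct1[OF conjunct2[OF conjunct2[OF conjunct2[OF s]]]] that by blast
qed

definition intersection_no :: "nat \<Rightarrow> nat \<Rightarrow> nat \<Rightarrow> nat" where
  "intersection_no i j k = (SOME p. \<forall>y z. R y z = k \<longrightarrow> card {w. R y w = i \<and> R w z = j} = p)"

lemma intersection_no: 
  assumes "i \<le> D" "j \<le> D"
  shows "card {w. R y w = i \<and> R w z = j} = intersection_no i j (R y z)"
proof -
  have "\<exists>p. \<forall>y' z'. R y' z' = R y z \<longrightarrow> card {w. R y' w = i \<and> R w z' = j} = p"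
    using conjunct2[OF conjunct2[OF conjunct2[OF conjunct2[OF scheme[unfolded sym_assoc_scheme_def]]]]]
      assms R_le[of y z] by blast
  from someI_ex[OF this] show ?thesis unfolding intersection_no_def by blast
qed

lemma BM_iff: "B \<in> BM R D \<longleftrightarrow> (\<exists>b. B = (\<lambda>y z. b (R y z)))"
proof
  assume "B \<in> BM R D"
  then obtain c where B: "B = (\<lambda>y z. \<Sum>i\<le>D. c i * adjm R i y z)" unfolding BM_def by blast
  have "B = (\<lambda>y z. (\<lambda>r. \<Sum>i\<le>D. c i * (if r = i then 1 else 0)) (R y z))"
    unfolding B adjm_def by simp
  then show "\<exists>b. B = (\<lambda>y z. b (R y z))"
    by (intro exI[of _ "\<lambda>r. \<Sum>i\<le>D. c i * (if r = i then 1 else 0)"])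
next
  assume "\<exists>b. B = (\<lambda>y z. b (R y z))"
  then obtain b where "B = (\<lambda>y z. b (R y z))" by blast
  then have "B = (\<lambda>y z. \<Sum>i\<le>D. b i * adjm R i y z)"
    by (simp add: adjm_def sum_nat_delta R_le fun_eq_iff)
  then show "B \<in> BM R D" unfolding BM_def by blast
qed

text \<open>Sorting \<open>w\<close> by its relations to \<open>y\<close> and \<open>z\<close> shows
  that the product depends on \<open>R y z\<close> only, so these matrices form an algebra.\<close>

lemma rel_product:
  "(\<Sum>w\<in>UNIV. b (R y w) * c (R w z)) = (\<Sum>i\<le>D. \<Sum>j\<le>D. b i * c j * of_nat (intersection_no i j (R y z)))"
  for b c :: "nat \<Rightarrow> complex"
proof -
  have "(\<Sum>w\<in>UNIV. b (R y w) * c (R w z)) =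
    (\<Sum>w\<in>UNIV. \<Sum>i\<le>D. \<Sum>j\<le>D. b i * c j * (if R y w = i \<and> R w z = j then 1 else 0))"
  proof (rule sum.cong[OF refl])
    fix w
    have "b (R y w) * c (R w z) =
      (\<Sum>i\<le>D. b i * (if R y w = i then 1 else 0)) * (\<Sum>j\<le>D. c j * (if R w z = j then 1 else 0))"
      by (simp only: sum_nat_delta[OF R_le])
    also have "\<dots> = (\<Sum>i\<le>D. \<Sum>j\<le>D. b i * c j * (if R y w = i \<and> R w z = j then 1 else 0))"
      unfolding sum_product by (intro sum.cong refl) auto
    finally show "b (R y w) * c (R w z) =
      (\<Sum>i\<le>D. \<Sum>j\<le>D. b i * c j * (if R y w = i \<and> R w z = j then 1 else 0))" .
  qed
  also have "\<dots> = (\<Sum>i\<le>D. \<Sum>w\<in>UNIV. \<Sum>j\<le>D. b i * c j * (if R y w = i \<and> R w z = j then 1 else 0))"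
    by (rule sum.swap)
  also have "\<dots> = (\<Sum>i\<le>D. \<Sum>j\<le>D. \<Sum>w\<in>UNIV. b i * c j * (if R y w = i \<and> R w z = j then 1 else 0))"
    by (intro sum.cong refl sum.swap)
  also have "\<dots> = (\<Sum>i\<le>D. \<Sum>j\<le>D. b i * c j * of_nat (intersection_no i j (R y z)))"
  proof (intro sum.cong refl)
    fix i j assume "i \<in> {..D}" "j \<in> {..D}"
    then have "card {w. R y w = i \<and> R w z = j} = intersection_no i j (R y z)" using intersection_no by simp
    moreover have "(\<Sum>w\<in>UNIV. (if R y w = i \<and> R w z = j then 1 else 0)) =
      (of_nat (card {w. R y w = i \<and> R w z = j}) :: complex)"
      by (simp add: sum.If_cases Int_def)
    ultimately show "(\<Sum>w\<in>UNIV. b i * c j * (if R y w = i \<and> R w z = j then 1 else 0)) =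
      b i * c j * of_nat (intersection_no i j (R y z))"
      by (simp only: sum_distrib_left[symmetric])
  qed
  finally show ?thesis .
qed

text \<open>The product depends only on \<open>R y z\<close>, which is symmetric; interchanging
  \<open>y\<close> and \<open>z\<close> exchanges the factors.\<close>

lemma rel_product_commute:
  "(\<Sum>w\<in>UNIV. b (R y w) * c (R w z)) = (\<Sum>w\<in>UNIV. c (R y w) * b (R w z))"
  for b c :: "nat \<Rightarrow> complex"
proof -
  have "(\<Sum>w\<in>UNIV. b (R y w) * c (R w z)) = (\<Sum>w\<in>UNIV. b (R z w) * c (R w y))"
    unfolding rel_product by (simp add: R_sym[of y z])
  also have "\<dots> = (\<Sum>w\<in>UNIV. c (R y w) * b (R w z))"
    by (rule sum.cong) (simp_all add: R_sym[of z] R_sym[of _ y] mult.commute)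
  finally show ?thesis .
qed

text \<open>This is the dual eigenvalue of \<open>E i\<close> on a relation, divided by the number
  of vertices.\<close>

definition E_entry :: "nat \<Rightarrow> nat \<Rightarrow> complex" where
  "E_entry i = (SOME b. E i = (\<lambda>y z. b (R y z)))"

lemma E_eq_entry: assumes "i \<le> D" shows "E i y z = E_entry i (R y z)"
proof -
  have "\<exists>b. E i = (\<lambda>y z. b (R y z))"
    using idem assms BM_iff unfolding prim_idempotents_def by blast
  from someI_ex[OF this] have "E i = (\<lambda>y z. E_entry i (R y z))" unfolding E_entry_def .
  then show ?thesis by metis
qed

lemma E_sym: "i \<le> D \<Longrightarrow> E i y z = E i z y"
  by (simp add: E_eq_entry R_sym[of y])

lemma E_0: "E 0 y z = 1 / of_nat CARD('x)"
  using idem unfolding prim_idempotents_def by simp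

lemma E_mult: "i \<le> D \<Longrightarrow> j \<le> D \<Longrightarrow> (\<Sum>w\<in>UNIV. E i y w * E j w z) = (if i = j then E i y z else 0)"
proof -
  assume "i \<le> D" "j \<le> D"
  then have "mmult (E i) (E j) = (if i = j then E i else (\<lambda>y z. 0))"
    using idem unfolding prim_idempotents_def by blast
  then have "mmult (E i) (E j) y z = (if i = j then E i y z else 0)" by simp
  then show ?thesis unfolding mmult_def .
qed

lemma E_sum: "(\<Sum>i\<le>D. E i y z) = (if y = z then 1 else 0)"
proof -
  have "(\<lambda>y z. \<Sum>i\<le>D. E i y z) = idm"
    using idem unfolding prim_idempotents_def by blast
  then show ?thesis unfolding idm_def by meson
qed

lemma E_nonzero: "i \<le> D \<Longrightarrow> \<exists>y z. E i y z \<noteq> 0"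
  using idem unfolding prim_idempotents_def by (metis (no_types, lifting) ext)

text \<open>For commuting \<open>E\<close> and \<open>cnj E\<close>, the matrix \<open>G = E - E (cnj E)\<close> satisfies
  \<open>G (cnj G) = 0\<close>, hence \<open>E = E (cnj E)\<close>, and the right-hand side is real.\<close>

lemma E_real: assumes i: "i \<le> D" shows "cnj (E i y z) = E i y z"
proof -
  let ?e = "E_entry i" and ?f = "\<lambda>r. cnj (E_entry i r)"
  define P where "P y z = (\<Sum>w\<in>UNIV. ?e (R y w) * ?f (R w z))" for y z
  define p where "p r = (\<Sum>k\<le>D. \<Sum>j\<le>D. ?e k * ?f j * of_nat (intersection_no k j r))" for r
  have Pp: "P y z = p (R y z)" for y z unfolding P_def p_def by (rule rel_product)
  have P': "P y z = (\<Sum>w\<in>UNIV. ?f (R y w) * ?e (R w z))" for y z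
    unfolding P_def by (rule rel_product_commute)
  have Preal: "cnj (P y z) = P y z" for y z
    by (subst P', simp add: P_def)
  have ee: "(\<Sum>w\<in>UNIV. ?e (R y w) * ?e (R w z)) = ?e (R y z)" for y z
    using E_mult[OF i i, of y z] by (simp add: E_eq_entry[OF i])
  have ff: "(\<Sum>w\<in>UNIV. ?f (R y w) * ?f (R w z)) = ?f (R y z)" for y z
    using arg_cong[OF ee[of y z], of cnj] by simp
  have eP: "(\<Sum>w\<in>UNIV. ?e (R y w) * P w z) = P y z" for y z
  proof -
    have "(\<Sum>w\<in>UNIV. ?e (R y w) * P w z) =
      (\<Sum>w\<in>UNIV. \<Sum>v\<in>UNIV. ?e (R y w) * ?e (R w v) * ?f (R v z))"
      by (simp add: P_def sum_distrib_left mult.assoc)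
    also have "\<dots> = (\<Sum>v\<in>UNIV. \<Sum>w\<in>UNIV. ?e (R y w) * ?e (R w v) * ?f (R v z))"
      by (rule sum.swap)
    also have "\<dots> = P y z" by (simp add: P_def sum_distrib_right[symmetric] ee)
    finally show ?thesis .
  qed
  have Pf: "(\<Sum>w\<in>UNIV. P y w * ?f (R w z)) = P y z" for y z
  proof -
    have "(\<Sum>w\<in>UNIV. P y w * ?f (R w z)) = (\<Sum>w\<in>UNIV. ?f (R y w) * p (R w z))"
      unfolding Pp by (rule rel_product_commute)
    also have "\<dots> = (\<Sum>w\<in>UNIV. cnj (?e (R y w) * P w z))"
      by (simp add: Preal Pp[symmetric])
    also have "\<dots> = cnj (\<Sum>w\<in>UNIV. ?e (R y w) * P w z)" by simp
    finally show ?thesis by (simp only: eP Preal)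
  qed
  have PP: "(\<Sum>w\<in>UNIV. P y w * P w z) = P y z" for y z
  proof -
    have "(\<Sum>w\<in>UNIV. P y w * P w z) =
      (\<Sum>w\<in>UNIV. \<Sum>v\<in>UNIV. P y w * ?f (R w v) * ?e (R v z))"
      by (simp add: P' sum_distrib_left mult.assoc)
    also have "\<dots> = (\<Sum>v\<in>UNIV. \<Sum>w\<in>UNIV. P y w * ?f (R w v) * ?e (R v z))"
      by (rule sum.swap)
    also have "\<dots> = (\<Sum>v\<in>UNIV. P y v * ?e (R v z))" by (simp add: sum_distrib_right[symmetric] Pf)
    also have "\<dots> = (\<Sum>v\<in>UNIV. ?e (R y v) * P v z)"
      unfolding Pp by (rule rel_product_commute)
    finally show ?thesis by (simp add: eP)
  qed
  define G where "G y z = ?e (R y z) - P y z" for y z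
  have "(\<Sum>z\<in>UNIV. G y z * cnj (G y z)) = 0" for y
  proof -
    \<comment> \<open>Each of the four sums equals \<open>P y y\<close>, so they cancel and row
      \<open>y\<close> of \<open>G\<close> has norm zero.\<close>
    have "(\<Sum>z\<in>UNIV. G y z * cnj (G y z)) =
      (\<Sum>z\<in>UNIV. ?e (R y z) * ?f (R z y)) - (\<Sum>z\<in>UNIV. ?e (R y z) * P z y)
       - (\<Sum>z\<in>UNIV. P y z * ?f (R z y)) + (\<Sum>z\<in>UNIV. P y z * P z y)"
      unfolding sum_subtractf[symmetric] sum.distrib[symmetric]
    proof (rule sum.cong[OF refl])
      fix z
      have "P z y = P y z" by (simp add: Pp R_sym[of z])
      then show "G y z * cnj (G y z) = ?e (R y z) * ?f (R z y) - ?e (R y z) * P z y -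
         P y z * ?f (R z y) + P y z * P z y"
        by (simp add: G_def Preal R_sym[of z] algebra_simps)
    qed
    then show ?thesis by (simp add: eP Pf PP) (simp add: P_def)
  qed
  then have "(\<Sum>z\<in>UNIV. (cmod (G y z))\<^sup>2) = 0" for y
    by (simp only: complex_norm_square[symmetric] of_real_sum[symmetric] of_real_eq_0_iff)
  then have "G y z = 0" for y z
    by (simp add: sum_nonneg_eq_0_iff)
  then have "E i y z = P y z" by (simp add: G_def E_eq_entry[OF i])
  then show ?thesis using Preal by simp
qed

section \<open>Relations as graph distances\<close>

lemma R_walk: "walk R (R y z) y z"
  and R_walk_le: "walk R n y z \<Longrightarrow> R y z \<le> n"
  using met unfolding metric_def by (auto simp: not_less[symmetric])

lemma walk_append:
  assumes "walk R m y w" "walk R n w z"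
  shows "walk R (m + n) y z"
proof -
  obtain p where p: "p 0 = y" "p m = w" "\<forall>k<m. R (p k) (p (Suc k)) = 1"
    using assms(1) unfolding walk_def by blast
  obtain q where q: "q 0 = w" "q n = z" "\<forall>k<n. R (q k) (q (Suc k)) = 1"
    using assms(2) unfolding walk_def by blast
  let ?f = "\<lambda>k. if k \<le> m then p k else q (k - m)"
  have 0: "?f 0 = y" "?f (m + n) = z" using p q by auto
  have 1: "R (?f k) (?f (Suc k)) = 1" if "k < m + n" for k
  proof -
    consider "k < m" | "k = m" | "m < k" by linarith
    then show ?thesis
    proof cases
      case 1
      then show ?thesis using p by auto
    next
      case 2
      then have "0 < n" using that by simp
      then have "R (q 0) (q (Suc 0)) = 1" using q by blast
      then show ?thesis using 2 p q by simp
    next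
      case 3
      then have "k - m < n" "Suc k - m = Suc (k - m)" using that by auto
      then show ?thesis using 3 q by auto
    qed
  qed
  show ?thesis unfolding walk_def by (intro exI[of _ ?f] conjI allI impI 0 1)
qed

lemma R_triangle: "R y z \<le> R y w + R w z"
  by (rule R_walk_le[OF walk_append[OF R_walk R_walk]])

text \<open>The first edge of a shortest walk; the triangle inequality shows that it shortens the
  distance by exactly one.\<close>

lemma R_step: assumes "R y z = Suc n" obtains w where "R y w = 1" "R w z = n"
proof -
  obtain p where p: "p 0 = y" "p (Suc n) = z" "\<forall>k<Suc n. R (p k) (p (Suc k)) = 1"
    using R_walk[of y z] unfolding assms walk_def by blast
  have 1: "R y (p 1) = 1" using p by (metis One_nat_def zero_less_Suc)
  have "walk R n (p 1) z" unfolding walk_def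
    using p by (intro exI[of _ "\<lambda>k. p (Suc k)"]) (auto simp: One_nat_def)
  then have "R (p 1) z \<le> n" by (rule R_walk_le)
  moreover have "Suc n \<le> 1 + R (p 1) z" using R_triangle[of y z "p 1"] 1 assms by simp
  ultimately show ?thesis using 1 that by simp
qed

lemma E_mult_row:
  assumes "i \<le> D" "j \<le> D"
  shows "(\<Sum>w\<in>UNIV. E i y w * E j z w) = (if i = j then E i y z else 0)"
proof -
  have "(\<Sum>w\<in>UNIV. E i y w * E j z w) = (\<Sum>w\<in>UNIV. E i y w * E j w z)"
    by (intro sum.cong refl arg_cong2[of _ _ _ _ "(*)"] E_sym assms)
  then show ?thesis by (simp only: E_mult[OF assms])
qed

lemma E_mult_col:
  assumes "i \<le> D" "j \<le> D"
  shows "(\<Sum>w\<in>UNIV. E i w y * E j w z) = (if i = j then E i y z else 0)"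
proof -
  have "(\<Sum>w\<in>UNIV. E i w y * E j w z) = (\<Sum>w\<in>UNIV. E i y w * E j w z)"
    by (intro sum.cong refl arg_cong2[of _ _ _ _ "(*)"] E_sym assms)
  then show ?thesis by (simp only: E_mult[OF assms])
qed

text \<open>Multiplication by the nonzero matrix \<open>E k\<close> isolates the \<open>k\<close>-th
  coefficient.\<close>

lemma E_coeff_unique:
  assumes "\<And>y z. (\<Sum>j\<le>D. c j * E j y z) = (\<Sum>j\<le>D. d j * E j y z)" "k \<le> D"
  shows "c k = d k"
proof -
  have *: "(\<Sum>w\<in>UNIV. (\<Sum>j\<le>D. c j * E j y w) * E k w z) = c k * E k y z" for c y z
  proof -
    have "(\<Sum>w\<in>UNIV. (\<Sum>j\<le>D. c j * E j y w) * E k w z) =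
      (\<Sum>w\<in>UNIV. \<Sum>j\<le>D. c j * (E j y w * E k w z))"
      by (simp add: sum_distrib_right mult.assoc)
    also have "\<dots> = (\<Sum>j\<le>D. \<Sum>w\<in>UNIV. c j * (E j y w * E k w z))" by (rule sum.swap)
    also have "\<dots> = (\<Sum>j\<le>D. c j * (if j = k then E j y z else 0))"
      using assms(2) by (simp add: sum_distrib_left[symmetric] E_mult)
    also have "\<dots> = (\<Sum>j\<le>D. if j = k then c j * E j y z else 0)" by (rule sum.cong) auto
    finally show ?thesis using assms(2) by simp
  qed
  obtain y z where nz: "E k y z \<noteq> 0" using E_nonzero[OF assms(2)] by blast
  have "c k * E k y z = d k * E k y z"
    unfolding *[of c y z, symmetric] *[of d y z, symmetric] assms(1) ..
  then show ?thesis using nz by simp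
qed

section \<open>Entrywise polynomials in \<open>E 1\<close>\<close>

definition epoly :: "nat \<Rightarrow> complex poly" where
  "epoly j = (SOME p. degree p = j \<and> E j = (\<lambda>y z. poly p (E 1 y z)))"

lemma epoly: assumes "j \<le> D"
  shows "degree (epoly j) = j" "E j y z = poly (epoly j) (E 1 y z)" "coeff (epoly j) j \<noteq> 0"
proof -
  have "\<exists>p. degree p = j \<and> E j = (\<lambda>y z. poly p (E 1 y z))"
    using comet assms unfolding cometric_def by blast
  from someI_ex[OF this] have *: "degree (epoly j) = j" "E j = (\<lambda>y z. poly (epoly j) (E 1 y z))"
    unfolding epoly_def by auto
  show d: "degree (epoly j) = j" by (rule *(1))
  show e: "E j y z = poly (epoly j) (E 1 y z)" for y z using *(2) by metis
  have "epoly j \<noteq> 0" using E_nonzero[OF assms] e by auto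
  then show "coeff (epoly j) j \<noteq> 0" using d leading_coeff_0_iff by metis
qed

text \<open>Since \<open>epoly (Suc m)\<close> has degree exactly \<open>Suc m\<close>, a multiple
  of it cancels the leading term. The constant \<open>a\<close> is \<open>a * CARD('x)\<close> times
  \<open>E 0\<close>.\<close>

lemma poly_E1_expansion:
  assumes "degree f \<le> m" "m \<le> D"
  shows "\<exists>c. (\<forall>y z. poly f (E 1 y z) = (\<Sum>j\<le>m. c j * E j y z)) \<and> (coeff f m \<noteq> 0 \<longrightarrow> c m \<noteq> 0)"
  using assms
proof (induction m arbitrary: f)
  case 0
  then obtain a where a: "f = [:a:]" using degree_eq_zeroE[of f] by auto
  have "poly f (E 1 y z) = (\<Sum>j\<le>0. (a * of_nat CARD('x)) * E j y z)" for y z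
    by (simp add: a E_0)
  moreover have "coeff f 0 \<noteq> 0 \<longrightarrow> a * of_nat CARD('x) \<noteq> 0" using a by simp
  ultimately show ?case by (intro exI[of _ "\<lambda>_. a * of_nat CARD('x)"]) auto
next
  case (Suc m)
  let ?b = "coeff f (Suc m) / coeff (epoly (Suc m)) (Suc m)"
  let ?g = "f - smult ?b (epoly (Suc m))"
  note ep = epoly[OF Suc.prems(2)]
  have "degree ?g \<le> Suc m"
    using Suc.prems ep(1) by (intro degree_diff_le order.trans[OF degree_smult_le]) auto
  moreover have "coeff ?g (Suc m) = 0" using ep(3) by simp
  ultimately have "degree ?g \<le> m"
    by (metis degree_0 le_SucE le_zero_eq leading_coeff_0_iff zero_le)
  from Suc.IH[OF this] Suc.prems obtain c
    where c: "\<And>y z. poly ?g (E 1 y z) = (\<Sum>j\<le>m. c j * E j y z)" by auto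
  have "poly f (E 1 y z) = (\<Sum>j\<le>Suc m. (c(Suc m := ?b)) j * E j y z)" for y z
  proof -
    have "poly f (E 1 y z) = poly ?g (E 1 y z) + ?b * E (Suc m) y z"
      by (simp add: ep(2))
    also have "poly ?g (E 1 y z) = (\<Sum>j\<le>m. c j * E j y z)" by (rule c)
    finally show ?thesis by simp
  qed
  moreover have "coeff f (Suc m) \<noteq> 0 \<longrightarrow> (c(Suc m := ?b)) (Suc m) \<noteq> 0" using ep(3) by simp
  ultimately show ?case by blast
qed

lemma poly_E1_expansion_D:
  assumes "degree f \<le> m" "m \<le> D"
  shows "\<exists>c. (\<forall>y z. poly f (E 1 y z) = (\<Sum>j\<le>D. c j * E j y z)) \<and>
    (coeff f m \<noteq> 0 \<longrightarrow> c m \<noteq> 0) \<and> (\<forall>j>m. c j = 0)"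
proof -
  obtain c where c: "\<And>y z. poly f (E 1 y z) = (\<Sum>j\<le>m. c j * E j y z)"
    "coeff f m \<noteq> 0 \<Longrightarrow> c m \<noteq> 0" using poly_E1_expansion[OF assms] by blast
  let ?c = "\<lambda>j. if j \<le> m then c j else 0"
  have "(\<Sum>j\<le>D. ?c j * E j y z) = (\<Sum>j\<le>m. ?c j * E j y z)" for y z
    using assms(2) by (intro sum.mono_neutral_right) auto
  moreover have "(\<Sum>j\<le>m. ?c j * E j y z) = (\<Sum>j\<le>m. c j * E j y z)" for y z
    by (rule sum.cong) auto
  ultimately have "poly f (E 1 y z) = (\<Sum>j\<le>D. ?c j * E j y z)" for y z using c(1) by simp
  then show ?thesis using c(2) by (intro exI[of _ ?c]) simp
qed

text \<open>If two entries agreed, a monic polynomial of degree at most \<open>D\<close> would annihilate \<open>E 1\<close>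
  entrywise and give a linear relation between the idempotents.\<close>

lemma inj_E_entry_1: "inj_on (E_entry 1) {..D}"
proof (rule ccontr)
  assume ninj: "\<not> ?thesis"
  let ?Q = "E_entry 1 ` {..D}"
  have "card ?Q \<le> D" using ninj card_image_le[of "{..D}" "E_entry 1"] 
    by (metis card_atMost eq_card_imp_inj_on finite_atMost le_SucE)
  define f where "f = (\<Prod>v\<in>?Q. [:- v, 1:])"
  have deg: "degree f = card ?Q" unfolding f_def by (simp add: degree_prod_eq_sum_degree)
  have "f \<noteq> 0" unfolding f_def by simp
  then have lead: "coeff f (card ?Q) \<noteq> 0" using deg leading_coeff_0_iff by metis
  obtain c where c: "\<And>y z. poly f (E 1 y z) = (\<Sum>j\<le>D. c j * E j y z)" "c (card ?Q) \<noteq> 0"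
    using poly_E1_expansion_D[OF eq_refl[OF deg] \<open>card ?Q \<le> D\<close>] lead by blast
  have "poly f (E 1 y z) = 0" for y z
    unfolding f_def poly_prod using R_le[of y z] E_eq_entry[OF D_pos] by (intro prod_zero) auto
  then have "(\<Sum>j\<le>D. c j * E j y z) = (\<Sum>j\<le>D. 0 * E j y z)" for y z using c(1) by simp
  from E_coeff_unique[of c "\<lambda>_. 0", OF this \<open>card ?Q \<le> D\<close>] c(2) show False by simp
qed

text \<open>The entries of \<open>E 1\<close> separate the relations, so interpolation writes any
  function of the relation as a polynomial of degree at most \<open>D\<close> in \<open>E 1\<close>,
  which expands in the idempotents.\<close>

lemma rel_in_span_E:
  "\<exists>c. \<forall>y z. b (R y z) = (\<Sum>j\<le>D. c j * E j y z)" for b :: "nat \<Rightarrow> complex"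
proof -
  obtain f where f: "degree f \<le> D" "\<And>i. i \<le> D \<Longrightarrow> poly f (E_entry 1 i) = b i"
    using lagrange_interpolation[OF inj_E_entry_1] by blast
  obtain c where "\<And>y z. poly f (E 1 y z) = (\<Sum>j\<le>D. c j * E j y z)"
    using poly_E1_expansion_D[OF f(1)] by blast
  then have "b (R y z) = (\<Sum>j\<le>D. c j * E j y z)" for y z
    using f(2)[OF R_le] E_eq_entry[OF D_pos] by metis
  then show ?thesis by blast
qed

section \<open>Krein parameters\<close>

text \<open>\<open>krein i j k\<close> is the Krein parameter divided by the number of vertices.\<close>

definition krein :: "nat \<Rightarrow> nat \<Rightarrow> nat \<Rightarrow> complex" where
  "krein i j = (SOME c. \<forall>y z. E i y z * E j y z = (\<Sum>k\<le>D. c k * E k y z))"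

lemma krein: assumes "i \<le> D" "j \<le> D" shows "E i y z * E j y z = (\<Sum>k\<le>D. krein i j k * E k y z)"
proof -
  have "\<exists>c. \<forall>y z. E i y z * E j y z = (\<Sum>k\<le>D. c k * E k y z)"
    using rel_in_span_E[of "\<lambda>r. E_entry i r * E_entry j r"] assms by (simp add: E_eq_entry)
  from someI_ex[OF this] show ?thesis unfolding krein_def by blast
qed

text \<open>A fully symmetric substitute for the Krein parameter: it vanishes for the same indices,
  so conditions proved for one order of the indices hold for all.\<close>

definition triple :: "nat \<Rightarrow> nat \<Rightarrow> nat \<Rightarrow> complex" where
  "triple i j k = (\<Sum>y\<in>UNIV. \<Sum>z\<in>UNIV. E i y z * E j y z * E k y z)"

lemma triple_perm: "triple i j k = triple i k j" "triple i j k = triple j i k"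
  unfolding triple_def by (simp_all add: mult_ac)

text \<open>For a real symmetric idempotent the trace is the squared Frobenius norm.\<close>

lemma E_trace_nonzero: assumes "k \<le> D" shows "(\<Sum>y\<in>UNIV. E k y y) \<noteq> 0"
proof
  have *: "(\<Sum>z\<in>UNIV. E k y z * cnj (E k y z)) = E k y y" for y
    using E_mult_row[OF assms assms, of y y] by (simp add: E_real[OF assms])
  assume "(\<Sum>y\<in>UNIV. E k y y) = 0"
  then have "(\<Sum>y\<in>UNIV. \<Sum>z\<in>UNIV. E k y z * cnj (E k y z)) = 0"
    unfolding * by simp
  then have "(\<Sum>y\<in>UNIV. \<Sum>z\<in>UNIV. (cmod (E k y z))\<^sup>2) = 0"
    by (simp only: complex_norm_square[symmetric] of_real_sum[symmetric] of_real_eq_0_iff)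
  then have "E k y z = 0" for y z
    by (simp add: sum_nonneg_eq_0_iff sum_nonneg)
  then show False using E_nonzero[OF assms] by blast
qed

lemma triple_krein:
  assumes "i \<le> D" "j \<le> D" "k \<le> D"
  shows "triple i j k = krein i j k * (\<Sum>y\<in>UNIV. E k y y)"
proof -
  have "(\<Sum>z\<in>UNIV. E i y z * E j y z * E k y z) = krein i j k * E k y y" for y
  proof -
    have "(\<Sum>z\<in>UNIV. E i y z * E j y z * E k y z) = (\<Sum>z\<in>UNIV. \<Sum>h\<le>D. krein i j h * (E h y z * E k y z))"
      using assms(1,2) by (simp add: krein sum_distrib_right mult.assoc)
    also have "\<dots> = (\<Sum>h\<le>D. \<Sum>z\<in>UNIV. krein i j h * (E h y z * E k y z))" by (rule sum.swap)
    also have "\<dots> = (\<Sum>h\<le>D. krein i j h * (if h = k then E h y y else 0))"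
      using assms by (simp add: sum_distrib_left[symmetric] E_mult_row)
    also have "\<dots> = (\<Sum>h\<le>D. if h = k then krein i j h * E h y y else 0)" by (rule sum.cong) auto
    finally show ?thesis using assms by simp
  qed
  then show ?thesis unfolding triple_def by (simp add: sum_distrib_left)
qed

lemma triple_zero_iff: "i \<le> D \<Longrightarrow> j \<le> D \<Longrightarrow> k \<le> D \<Longrightarrow> triple i j k = 0 \<longleftrightarrow> krein i j k = 0"
  by (simp add: triple_krein E_trace_nonzero)

text \<open>The entrywise product is a polynomial of degree at most \<open>i + j\<close> in
  \<open>E 1\<close>, so its expansion stops at \<open>i + j\<close>.\<close>

lemma krein_degree: 
  assumes "i \<le> D" "j \<le> D" "i + j < k" "k \<le> D" 
  shows "krein i j k = 0"
proof -
  let ?f = "epoly i * epoly j"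
  have "degree ?f \<le> i + j" "i + j \<le> D" using degree_mult_le[of "epoly i" "epoly j"] epoly(1) assms by auto
  from poly_E1_expansion_D[OF this] obtain c
    where c: "\<And>y z. poly ?f (E 1 y z) = (\<Sum>j\<le>D. c j * E j y z)" "\<And>h. i + j < h \<Longrightarrow> c h = 0" by blast
  have "(\<Sum>h\<le>D. krein i j h * E h y z) = (\<Sum>h\<le>D. c h * E h y z)" for y z
    using krein[of i j y z] c(1)[of y z] assms epoly(2)[of i y z] epoly(2)[of j y z] by simp
  from E_coeff_unique[OF this assms(4)] c(2) assms show ?thesis by simp
qed

lemma krein_triangle:
  assumes "i \<le> D" "j \<le> D" "k \<le> D" "i + j < k \<or> j + k < i \<or> i + k < j"
  shows "krein i j k = 0"
proof -
  have "triple i j k = 0"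
    using assms krein_degree[of i j k] krein_degree[of j k i] krein_degree[of i k j]
      triple_zero_iff[of i j k] triple_zero_iff[of j k i] triple_zero_iff[of i k j]
      triple_perm by metis
  then show ?thesis using assms triple_zero_iff by blast
qed

text \<open>Entrywise multiplication by \<open>E 1\<close> raises the degree of
  \<open>epoly j\<close> by exactly one, so the coefficient at \<open>Suc j\<close>
  survives.\<close>

lemma krein_1_up: assumes "Suc j \<le> D" shows "krein 1 j (Suc j) \<noteq> 0"
proof -
  let ?f = "pCons 0 (epoly j)"
  have jD: "j \<le> D" using assms by simp
  have "degree ?f \<le> Suc j" using epoly(1)[OF jD] degree_pCons_le[of 0 "epoly j"] by simp
  moreover have "coeff ?f (Suc j) \<noteq> 0" using epoly(3)[OF jD] by simp
  ultimately obtain c where c: "\<And>y z. poly ?f (E 1 y z) = (\<Sum>j\<le>D. c j * E j y z)" "c (Suc j) \<noteq> 0"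
    using poly_E1_expansion_D[OF _ assms, of ?f] by blast
  have "(\<Sum>h\<le>D. krein 1 j h * E h y z) = (\<Sum>h\<le>D. c h * E h y z)" for y z
    using krein[of 1 j y z] c(1)[of y z] D_pos jD epoly(2)[OF jD, of y z] by simp
  from E_coeff_unique[OF this assms] c(2) show ?thesis by simp
qed

lemma krein_1_down: assumes "Suc j \<le> D" shows "krein 1 (Suc j) j \<noteq> 0"
proof -
  have jD: "j \<le> D" using assms by simp
  have "triple 1 j (Suc j) \<noteq> 0" using krein_1_up[OF assms] triple_zero_iff[OF D_pos jD assms] by blast
  then have "triple 1 (Suc j) j \<noteq> 0" unfolding triple_perm(1)[of 1 "Suc j" j] .
  then show ?thesis using triple_zero_iff[OF D_pos assms jD] by blast
qed

text \<open>The squared Frobenius norm of \<open>E i * Astar j * E k\<close> is a multiple of \<open>krein i k j\<close>.\<close>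

lemma E_Astar_E_zero:
  assumes i: "i \<le> D" and j: "j \<le> D" and k: "k \<le> D" and krein0: "krein i k j = 0"
  shows "(\<Sum>u\<in>UNIV. E i y u * E j x u * E k u z) = 0"
proof -
  define a where "a u = E j x u" for u
  define M where "M y z = (\<Sum>u\<in>UNIV. E i y u * a u * E k u z)" for y z
  have cM: "cnj (M y z) = M y z" for y z
    unfolding M_def a_def using i j k by (simp add: E_real)
  have Ek: "(\<Sum>z\<in>UNIV. E k u z * E k v z) = E k u v" for u v
    using E_mult_row[OF k k] by simp
  have Ei: "(\<Sum>y\<in>UNIV. E i y u * E i y v) = E i u v" for u v
    using E_mult_col[OF i i] by simp
  have "(\<Sum>z\<in>UNIV. M y z * M y z) = (\<Sum>u\<in>UNIV. \<Sum>v\<in>UNIV. a u * a v * E k u v * (E i y u * E i y v))" for y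
  proof -
    have "(\<Sum>z\<in>UNIV. M y z * M y z) =
      (\<Sum>z\<in>UNIV. \<Sum>u\<in>UNIV. \<Sum>v\<in>UNIV. (a u * a v * (E i y u * E i y v)) * (E k u z * E k v z))"
      unfolding M_def sum_product by (intro sum.cong refl) (simp only: mult_ac)
    also have "\<dots> = (\<Sum>u\<in>UNIV. \<Sum>v\<in>UNIV. (a u * a v * (E i y u * E i y v)) * (\<Sum>z\<in>UNIV. E k u z * E k v z))"
      unfolding sum_distrib_left by (rule sum_swap3)
    finally show ?thesis unfolding Ek by (simp only: mult_ac)
  qed
  then have "(\<Sum>y\<in>UNIV. \<Sum>z\<in>UNIV. M y z * M y z) =
    (\<Sum>y\<in>UNIV. \<Sum>u\<in>UNIV. \<Sum>v\<in>UNIV. a u * a v * E k u v * (E i y u * E i y v))" by simp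
  also have "\<dots> = (\<Sum>u\<in>UNIV. \<Sum>v\<in>UNIV. a u * a v * E k u v * (\<Sum>y\<in>UNIV. E i y u * E i y v))"
    unfolding sum_distrib_left by (rule sum_swap3)
  also have "\<dots> = (\<Sum>u\<in>UNIV. \<Sum>v\<in>UNIV. \<Sum>h\<le>D. (a u * krein i k h) * (E h u v * a v))"
    unfolding Ei
  proof (intro sum.cong refl)
    fix u v
    have "a u * a v * E k u v * E i u v = a u * a v * (E i u v * E k u v)" by (simp only: mult_ac)
    also have "\<dots> = (\<Sum>h\<le>D. (a u * krein i k h) * (E h u v * a v))"
      unfolding krein[OF i k] sum_distrib_left by (intro sum.cong refl) (simp only: mult_ac)
    finally show "a u * a v * E k u v * E i u v = (\<Sum>h\<le>D. (a u * krein i k h) * (E h u v * a v))" .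
  qed
  also have "\<dots> = (\<Sum>u\<in>UNIV. \<Sum>h\<le>D. \<Sum>v\<in>UNIV. (a u * krein i k h) * (E h u v * a v))"
    by (intro sum.cong refl sum.swap)
  also have "\<dots> = (\<Sum>u\<in>UNIV. \<Sum>h\<le>D. (a u * krein i k h) * (\<Sum>v\<in>UNIV. E h u v * E j x v))"
    unfolding sum_distrib_left a_def ..
  \<comment> \<open>The inner sum vanishes unless \<open>h = j\<close>, and for \<open>h = j\<close>
    the factor \<open>krein i k j\<close> is zero.\<close>
  also have "\<dots> = 0"
    using krein0 j by (intro sum.neutral ballI) (simp add: E_mult_row)
  finally have "(\<Sum>y\<in>UNIV. \<Sum>z\<in>UNIV. M y z * cnj (M y z)) = 0" by (simp only: cM)
  then have "(\<Sum>y\<in>UNIV. \<Sum>z\<in>UNIV. (cmod (M y z))\<^sup>2) = 0"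
    by (simp only: complex_norm_square[symmetric] of_real_sum[symmetric] of_real_eq_0_iff)
  then have "M y z = 0" for y z
    by (simp add: sum_nonneg_eq_0_iff sum_nonneg)
  then show ?thesis unfolding M_def a_def .
qed

end

section \<open>The scheme and its dual as polynomial actions\<close>

lemma mapply_Estar: "mapply (Estar R x i) v y = (if R x y = i then v y else 0)"
  unfolding Estar_def mapply_diag by (simp add: adjm_def)

lemma mapply_Astar: "mapply (Astar E x i) v y = of_nat CARD('x) * E i x y * v (y::'x::finite)"
  unfolding Astar_def by (rule mapply_diag)

context pq_scheme
begin

lemma E_action_E:
  assumes "i \<le> D" "j \<le> D"
  shows "mapply (E i) (mapply (E j) v) = (if i = j then mapply (E i) v else 0)"
proof -
  have "mmult (E i) (E j) = (\<lambda>y z. if i = j then E i y z else 0)"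
    by (simp add: mmult_def fun_eq_iff E_mult[OF assms])
  then have "mapply (E i) (mapply (E j) v) = mapply (\<lambda>y z. if i = j then E i y z else 0) v"
    by (simp add: mapply_mmult[symmetric])
  then show ?thesis by (auto simp: mapply_def fun_eq_iff)
qed

lemma E_action_sum: "(\<Sum>j\<le>D. mapply (E j) v) = v"
proof -
  have "(\<Sum>j\<le>D. cscale 1 (mapply (E j) v)) = mapply (\<lambda>y z. \<Sum>j\<le>D. 1 * E j y z) v"
    by (rule mapply_sum_mat[symmetric])
  also have "(\<lambda>y z. \<Sum>j\<le>D. 1 * E j y z) = idm"
    by (simp add: E_sum idm_def fun_eq_iff)
  finally show ?thesis by (simp add: mapply_idm cscale_def)
qed

text \<open>The eigenvalue is the coefficient of \<open>E j\<close> when \<open>adjm R 1\<close> is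
  expanded in the idempotents.\<close>

lemma adjm_action_E:
  assumes "j \<le> D"
  shows "\<exists>\<theta>. \<forall>v. mapply (adjm R 1) (mapply (E j) v) = cscale \<theta> (mapply (E j) v)"
proof -
  interpret vector_space "cscale :: complex \<Rightarrow> 'x cvec \<Rightarrow> 'x cvec" by (rule vector_space_cscale)
  obtain c where c: "\<And>y z. (if R y z = 1 then 1 else 0) = (\<Sum>l\<le>D. c l * E l y z)"
    using rel_in_span_E[of "\<lambda>r. if r = 1 then 1 else 0"] by blast
  have "adjm R 1 = (\<lambda>y z. \<Sum>l\<le>D. c l * E l y z)" unfolding adjm_def c ..
  then have "mapply (adjm R 1) (mapply (E j) v) =
    (\<Sum>l\<le>D. cscale (c l) (mapply (E l) (mapply (E j) v)))" for v
    by (simp only: mapply_sum_mat)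
  also have "\<dots> v = (\<Sum>l\<le>D. if l = j then cscale (c j) (mapply (E j) v) else 0)" for v
    by (rule sum.cong) (auto simp: E_action_E assms)
  finally show ?thesis using assms by auto
qed

lemma E_in_span_adjm:
  assumes "j \<le> D"
  shows "\<exists>c. \<forall>v. mapply (E j) v = (\<Sum>i\<le>D. cscale (c i) (mapply (adjm R i) v))"
proof -
  have eq: "E j = (\<lambda>y z. \<Sum>i\<le>D. E_entry j i * adjm R i y z)"
    by (simp add: adjm_def sum_nat_delta R_le fun_eq_iff E_eq_entry[OF assms])
  show ?thesis by (intro exI[of _ "E_entry j"] allI, subst eq, rule mapply_sum_mat)
qed

lemma intersection_no_zero:
  assumes "j \<le> D" "k \<le> D" "k + 1 < j \<or> j + 1 < k"
  shows "intersection_no 1 j k = 0"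
proof -
  obtain y z where yz: "R y z = k" using R_surj[OF assms(2)] by blast
  have e: "{w. R y w = 1 \<and> R w z = j} = {}"
  proof (rule ccontr)
    assume "\<not> ?thesis"
    then obtain w where w: "R y w = 1" "R w z = j" by blast
    show False using R_triangle[of y z w] R_triangle[of w z y] w yz assms(3) R_sym[of w y] by simp
  qed
  show ?thesis using intersection_no[OF D_pos assms(1), of y z] unfolding e yz by simp
qed

text \<open>\<open>R_step\<close>, applied to the larger of the two distances, supplies a
  configuration that is counted.\<close>

lemma intersection_no_nonzero:
  assumes "j \<le> D" "k \<le> D" "k + 1 = j \<or> k = j + 1"
  shows "intersection_no 1 j k \<noteq> 0"
proof -
  obtain y w z where yz: "R y z = k" "R y w = 1" "R w z = j"
  proof (cases "k + 1 = j")
    case True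
    obtain w z where w: "R w z = j" using R_surj[OF assms(1)] by blast
    then have "R w z = Suc k" using True by simp
    then obtain y where "R w y = 1" "R y z = k" by (rule R_step)
    then show ?thesis using that[of y z w] w True R_sym[of w y] by simp
  next
    case False
    obtain y z where y: "R y z = k" using R_surj[OF assms(2)] by blast
    then have "R y z = Suc j" using False assms(3) by simp
    then obtain w where "R y w = 1" "R w z = j" by (rule R_step)
    then show ?thesis using that[of y z w] y False assms(3) by simp
  qed
  then have "card {w. R y w = 1 \<and> R w z = j} \<noteq> 0" by auto
  then show ?thesis unfolding intersection_no[OF D_pos assms(1)] yz(1) .
qed

lemma adjm_recurrence:
  assumes "j \<le> D"
  shows "mapply (adjm R 1) (mapply (adjm R j) v) =
    (\<Sum>k\<le>D. cscale (of_nat (intersection_no 1 j k)) (mapply (adjm R k) v))"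
proof -
  have "mmult (adjm R 1) (adjm R j) = (\<lambda>y z. \<Sum>k\<le>D. of_nat (intersection_no 1 j k) * adjm R k y z)"
  proof (intro ext)
    fix y z
    have "mmult (adjm R 1) (adjm R j) y z = (\<Sum>w\<in>UNIV. if R y w = 1 \<and> R w z = j then 1 else 0)"
      unfolding mmult_def adjm_def by (rule sum.cong) auto
    also have "\<dots> = of_nat (card {w. R y w = 1 \<and> R w z = j})"
      by (simp add: sum.If_cases Int_def)
    also have "\<dots> = of_nat (intersection_no 1 j (R y z))" by (simp only: intersection_no[OF D_pos assms])
    also have "\<dots> = (\<Sum>k\<le>D. of_nat (intersection_no 1 j k) * adjm R k y z)"
      unfolding adjm_def by (rule sum_nat_delta[OF R_le, symmetric])
    finally show "mmult (adjm R 1) (adjm R j) y z = (\<Sum>k\<le>D. of_nat (intersection_no 1 j k) * adjm R k y z)" .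
  qed
  then show ?thesis by (simp only: mapply_mmult[symmetric] mapply_sum_mat)
qed

text \<open>A nonzero entry would give vertices whose distances from \<open>x\<close> and from each
  other violate the triangle inequality.\<close>

lemma Estar_adjm_Estar:
  assumes "i + j < k \<or> j + k < i \<or> i + k < j"
  shows "mapply (Estar R x i) (mapply (adjm R j) (mapply (Estar R x k) v)) = 0"
proof
  fix y
  have "mapply (adjm R j) (mapply (Estar R x k) v) y = 0" if "R x y = i"
    unfolding mapply_def[of "adjm R j"]
  proof (intro sum.neutral ballI)
    fix w
    show "adjm R j y w * mapply (Estar R x k) v w = 0"
      using R_triangle[of x w y] R_triangle[of x y w] R_triangle[of y w x] R_sym[of y x]
        R_sym[of w y] assms that
      by (auto simp: adjm_def mapply_Estar)
  qed
  then show "mapply (Estar R x i) (mapply (adjm R j) (mapply (Estar R x k) v)) y = 0 y"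
    by (simp add: mapply_Estar)
qed

lemma P_polynomial:
  "polynomial_action cscale D (\<lambda>i. mapply (adjm R i)) (\<lambda>i. mapply (E i)) (\<lambda>i. mapply (Estar R x i))"
proof -
  interpret vector_space "cscale :: complex \<Rightarrow> 'x cvec \<Rightarrow> 'x cvec" by (rule vector_space_cscale)
  have "adjm R 0 = idm" by (auto simp: adjm_def idm_def fun_eq_iff R_0)
  then have A0: "mapply (adjm R 0) v = v" for v by (simp add: mapply_idm)
  show ?thesis
  proof unfold_locales
    fix j assume j: "j \<le> D"
    show "\<exists>p. (\<forall>v. mapply (adjm R 1) (mapply (adjm R j) v) = (\<Sum>k\<le>D. cscale (p k) (mapply (adjm R k) v))) \<and>
      (\<forall>k\<le>D. (k + 1 < j \<or> j + 1 < k \<longrightarrow> p k = 0) \<and> (k + 1 = j \<or> k = j + 1 \<longrightarrow> p k \<noteq> 0))"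
      using adjm_recurrence[OF j] intersection_no_zero[OF j] intersection_no_nonzero[OF j]
      by (intro exI[of _ "\<lambda>k. of_nat (intersection_no 1 j k)"]) simp
  qed (auto simp: D_pos mapply_add mapply_scale E_action_E E_action_sum adjm_action_E E_in_span_adjm A0
      Estar_adjm_Estar)
qed

lemma Estar_in_span_Astar:
  assumes "j \<le> D"
  shows "\<exists>c. \<forall>v. mapply (Estar R x j) v = (\<Sum>i\<le>D. cscale (c i) (mapply (Astar E x i) v))"
proof -
  obtain c where c: "\<And>y z. (if R y z = j then 1 else 0) = (\<Sum>l\<le>D. c l * E l y z)"
    using rel_in_span_E[of "\<lambda>r. if r = j then 1 else 0"] by blast
  have "mapply (Estar R x j) v y = (\<Sum>i\<le>D. cscale (c i / of_nat CARD('x)) (mapply (Astar E x i) v)) y" for v y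
  proof -
    have "mapply (Estar R x j) v y = (if R x y = j then 1 else 0) * v y"
      by (simp add: mapply_Estar)
    also have "\<dots> = (\<Sum>i\<le>D. (c i / of_nat CARD('x)) * (of_nat CARD('x) * E i x y * v y))"
      unfolding c by (simp add: sum_distrib_right mult.assoc)
    finally show ?thesis by (simp add: sum_fun_apply cscale_def mapply_Astar)
  qed
  then show ?thesis by (intro exI[of _ "\<lambda>i. c i / of_nat CARD('x)"]) (simp add: fun_eq_iff)
qed

text \<open>The left side carries two factors \<open>CARD('x)\<close>; one is absorbed in
  \<open>Astar E x k\<close>, the other turns \<open>krein\<close> into the usual Krein
  parameter.\<close>

lemma Astar_recurrence:
  assumes "j \<le> D"
  shows "mapply (Astar E x 1) (mapply (Astar E x j) v) =
    (\<Sum>k\<le>D. cscale (of_nat CARD('x) * krein 1 j k) (mapply (Astar E x k) v))"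
proof
  fix y
  have "mapply (Astar E x 1) (mapply (Astar E x j) v) y =
    of_nat CARD('x) * of_nat CARD('x) * (E 1 x y * E j x y) * v y"
    by (simp add: mapply_Astar)
  also have "\<dots> = (\<Sum>k\<le>D. of_nat CARD('x) * krein 1 j k * (of_nat CARD('x) * E k x y * v y))"
    unfolding krein[OF D_pos assms] sum_distrib_left sum_distrib_right
    by (intro sum.cong refl) (simp only: mult_ac)
  finally show "mapply (Astar E x 1) (mapply (Astar E x j) v) y =
    (\<Sum>k\<le>D. cscale (of_nat CARD('x) * krein 1 j k) (mapply (Astar E x k) v)) y"
    by (simp add: sum_fun_apply cscale_def mapply_Astar)
qed

lemma E_Astar_E:
  assumes "i \<le> D" "j \<le> D" "k \<le> D" "i + j < k \<or> j + k < i \<or> i + k < j"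
  shows "mapply (E i) (mapply (Astar E x j) (mapply (E k) v)) = 0"
proof
  fix y
  have "krein i k j = 0" using assms by (intro krein_triangle) auto
  note z = E_Astar_E_zero[OF assms(1,2,3) this]
  have "mapply (E i) (mapply (Astar E x j) (mapply (E k) v)) y =
    (\<Sum>u\<in>UNIV. \<Sum>w\<in>UNIV. of_nat CARD('x) * ((E i y u * E j x u * E k u w) * v w))"
    unfolding mapply_def[of "E i"] mapply_Astar mapply_def[of "E k"] sum_distrib_left
    by (intro sum.cong refl) (simp only: mult_ac)
  also have "\<dots> = (\<Sum>w\<in>UNIV. \<Sum>u\<in>UNIV. of_nat CARD('x) * ((E i y u * E j x u * E k u w) * v w))"
    by (rule sum.swap)
  also have "\<dots> = (\<Sum>w\<in>UNIV. of_nat CARD('x) * ((\<Sum>u\<in>UNIV. E i y u * E j x u * E k u w) * v w))"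
    by (simp only: sum_distrib_left sum_distrib_right)
  also have "\<dots> = 0" unfolding z by simp
  finally show "mapply (E i) (mapply (Astar E x j) (mapply (E k) v)) y = 0 y" by simp
qed

lemma Q_polynomial:
  "polynomial_action cscale D (\<lambda>i. mapply (Astar E x i)) (\<lambda>i. mapply (Estar R x i)) (\<lambda>i. mapply (E i))"
proof -
  interpret vector_space "cscale :: complex \<Rightarrow> 'x cvec \<Rightarrow> 'x cvec" by (rule vector_space_cscale)
  have EE: "mapply (Estar R x i) (mapply (Estar R x j) v) = (if i = j then mapply (Estar R x i) v else 0)"
    for i j v by (auto simp: fun_eq_iff mapply_Estar)
  have ES: "(\<Sum>j\<le>D. mapply (Estar R x j) v) = v" for v
    by (simp add: fun_eq_iff sum_fun_apply mapply_Estar R_le)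
  have eig: "\<exists>\<theta>. \<forall>v. mapply (Astar E x 1) (mapply (Estar R x j) v) = cscale \<theta> (mapply (Estar R x j) v)" for j
    by (intro exI[of _ "of_nat CARD('x) * E_entry 1 j"])
      (auto simp: fun_eq_iff mapply_Astar mapply_Estar cscale_def E_eq_entry[OF D_pos])
  have A0: "mapply (Astar E x 0) v = v" for v
    by (simp add: fun_eq_iff mapply_Astar E_0)
  show ?thesis
  proof unfold_locales
    fix j assume j: "j \<le> D"
    have "krein 1 j k = 0" if "k \<le> D" "k + 1 < j \<or> j + 1 < k" for k
      using that j by (intro krein_triangle D_pos) auto
    moreover have "krein 1 j k \<noteq> 0" if "k \<le> D" "k + 1 = j \<or> k = j + 1" for k
      using that j krein_1_up[of j] krein_1_down[of k] unfolding Suc_eq_plus1 by auto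
    ultimately show "\<exists>p. (\<forall>v. mapply (Astar E x 1) (mapply (Astar E x j) v) = (\<Sum>k\<le>D. cscale (p k) (mapply (Astar E x k) v))) \<and>
      (\<forall>k\<le>D. (k + 1 < j \<or> j + 1 < k \<longrightarrow> p k = 0) \<and> (k + 1 = j \<or> k = j + 1 \<longrightarrow> p k \<noteq> 0))"
      using Astar_recurrence[OF j]
      by (intro exI[of _ "\<lambda>k. of_nat CARD('x) * krein 1 j k"]) simp
  qed (auto simp: D_pos mapply_add mapply_scale EE ES eig Estar_in_span_Astar A0 E_Astar_E)
qed

lemma pq_action:
  "pq_action cscale D (\<lambda>i. mapply (adjm R i)) (\<lambda>i. mapply (E i))
     (\<lambda>i. mapply (Astar E x i)) (\<lambda>i. mapply (Estar R x i))"
  by (intro pq_action.intro P_polynomial Q_polynomial)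

end

locale pointed_pq_scheme = pq_scheme R D E
  for R :: "'x::finite \<Rightarrow> 'x \<Rightarrow> nat" and D :: nat and E :: "nat \<Rightarrow> 'x cmat" +
  fixes x :: 'x

sublocale pointed_pq_scheme \<subseteq> act: pq_action cscale D "\<lambda>i. mapply (adjm R i)" "\<lambda>i. mapply (E i)"
     "\<lambda>i. mapply (Astar E x i)" "\<lambda>i. mapply (Estar R x i)"
  by (rule pq_action)

section \<open>Orthogonal decomposition and codes\<close>

text \<open>Moves to the real Euclidean space \<open>complex ^ 'x\<close>, where orthogonal
  decomposition and dimension are available.\<close>

lemma csubspace_real_subspace:
  assumes "csubspace (W :: 'x::finite cvec set)"
  shows "subspace {w :: complex ^ 'x. vec_nth w \<in> W}"
proof -
  interpret V: vector_space "cscale :: complex \<Rightarrow> 'x cvec \<Rightarrow> 'x cvec" by (rule vector_space_cscale)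
  have W: "V.subspace W" using assms subspace_cscale by blast
  have "vec_nth (u + v) = vec_nth u + vec_nth v" for u v :: "complex ^ 'x"
    by (simp add: fun_eq_iff)
  moreover have "vec_nth (c *\<^sub>R u) = cscale (of_real c) (vec_nth u)" for c and u :: "complex ^ 'x"
    by (simp add: fun_eq_iff cscale_def scaleR_conv_of_real[where 'a = complex])
  moreover have "vec_nth (0 :: complex ^ 'x) = 0" by (simp add: fun_eq_iff)
  ultimately show ?thesis
    unfolding subspace_def using V.subspace_0[OF W] V.subspace_add[OF W] V.subspace_scale[OF W] by simp
qed

lemma inner_vec_cinner: "inner u v = Re (cinner (vec_nth u) (vec_nth v))" for u v :: "complex ^ 'x"
  by (simp add: inner_vec_def cinner_def inner_complex_def)

lemma cinner_scale_right: "cinner u (cscale c v) = cnj c * cinner u v"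
  by (simp add: cinner_def cscale_def sum_distrib_left mult_ac)

lemma cinner_scale_left: "cinner (cscale c u) v = c * cinner u v"
  by (simp add: cinner_def cscale_def sum_distrib_left mult_ac)

lemma cinner_add_left: "cinner (u + v) w = cinner u w + cinner v w"
  by (simp add: cinner_def sum.distrib algebra_simps)

lemma cinner_add_right: "cinner w (u + v) = cinner w u + cinner w v"
  by (simp add: cinner_def sum.distrib algebra_simps)

lemma cinner_zero_right: "cinner u 0 = 0"
  by (simp add: cinner_def)

lemma cinner_self_zero: assumes "cinner u u = 0" shows "u = 0"
proof -
  have "(\<Sum>y\<in>UNIV. (cmod (u y))\<^sup>2) = 0"
    using assms unfolding cinner_def
    by (simp only: complex_norm_square[symmetric] of_real_sum[symmetric] of_real_eq_0_iff)
  then show ?thesis by (simp add: sum_nonneg_eq_0_iff fun_eq_iff)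
qed

definition cperp :: "'x::finite cvec set \<Rightarrow> 'x cvec set" where
  "cperp W = {v. \<forall>w\<in>W. cinner v w = 0}"

lemma cperp_Int_zero: "v \<in> W \<Longrightarrow> v \<in> cperp W \<Longrightarrow> v = 0"
  unfolding cperp_def using cinner_self_zero by blast

lemma cperp_decomposition:
  assumes W: "csubspace W"
  obtains w p where "w \<in> W" "p \<in> cperp W" "v = w + p"
proof -
  let ?S = "{w :: complex ^ 'a. vec_nth w \<in> W}"
  have S: "span ?S = ?S" using csubspace_real_subspace[OF W] by simp
  obtain a b where ab: "a \<in> ?S" "\<And>w. w \<in> ?S \<Longrightarrow> orthogonal b w" "vec_lambda v = a + b"
    using orthogonal_subspace_decomp_exists[of ?S "vec_lambda v"] unfolding S by blast
  have "cinner (vec_nth b) w = 0" if w: "w \<in> W" for w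
  proof -
    have 1: "Re (cinner (vec_nth b) u) = 0" if "u \<in> W" for u
      using ab(2)[of "vec_lambda u"] that by (simp add: orthogonal_def inner_vec_cinner vec_lambda_inverse)
    \<comment> \<open>Real orthogonality controls only the real part of \<open>cinner\<close>;
      testing with \<open>\<i>\<close> times \<open>w\<close> controls the imaginary part.\<close>
    have "cscale \<i> w \<in> W" using W w unfolding csubspace_def cscale_def by blast
    from 1[OF this] 1[OF w] show ?thesis by (simp add: cinner_scale_right complex_eq_iff)
  qed
  moreover have "v = vec_nth a + vec_nth b"
    using arg_cong[OF ab(3), of vec_nth] by (simp add: fun_eq_iff)
  ultimately show ?thesis using that ab(1) unfolding cperp_def by blast
qed

text \<open>Real dimension, serving only as a measure that drops on proper complex
  subspaces.\<close>

definition rdim :: "'x::finite cvec set \<Rightarrow> nat" where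
  "rdim W = dim {w :: complex ^ 'x. vec_nth w \<in> W}"

lemma rdim_psubset:
  assumes "csubspace U" "csubspace W" "U \<subset> W"
  shows "rdim U < rdim W"
proof -
  let ?U = "{w :: complex ^ 'a. vec_nth w \<in> U}" and ?W = "{w :: complex ^ 'a. vec_nth w \<in> W}"
  obtain w where w: "w \<in> W" "w \<notin> U" using assms(3) by blast
  have "vec_lambda w \<in> ?W" "vec_lambda w \<notin> ?U" using w by (auto simp: vec_lambda_inverse)
  then have "?U \<subset> ?W" using assms(3) by blast
  then have "span ?U \<subset> span ?W"
    using csubspace_real_subspace[OF assms(1)] csubspace_real_subspace[OF assms(2)]
    by (simp only: span_eq_iff[THEN iffD2])
  then show ?thesis unfolding rdim_def by (rule dim_psubset)
qed

definition adjoint :: "'x cmat \<Rightarrow> 'x cmat" where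
  "adjoint F = (\<lambda>y z. cnj (F z y))"

lemma cinner_adjoint: "cinner (mapply F u) v = cinner u (mapply (adjoint F) v)"
proof -
  have "cinner (mapply F u) v = (\<Sum>y\<in>UNIV. \<Sum>w\<in>UNIV. F y w * u w * cnj (v y))"
    by (simp add: cinner_def mapply_def sum_distrib_right)
  also have "\<dots> = (\<Sum>w\<in>UNIV. \<Sum>y\<in>UNIV. F y w * u w * cnj (v y))" by (rule sum.swap)
  also have "\<dots> = cinner u (mapply (adjoint F) v)"
    by (simp add: cinner_def mapply_def adjoint_def sum_distrib_left mult_ac)
  finally show ?thesis .
qed

section \<open>Modules for \<open>T\<close> and their orthogonal complements\<close>

context pointed_pq_scheme
begin

text \<open>The generators are self-adjoint: \<open>adjm R i\<close> is real symmetric, and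
  \<open>Astar E x i\<close> is diagonal and real by \<open>E_real\<close>.\<close>

lemma adjoint_Talg: "F \<in> Talg R D E x \<Longrightarrow> adjoint F \<in> Talg R D E x"
proof (induction rule: Talg.induct)
  case (gen_A i)
  have "adjoint (adjm R i) = adjm R i" by (auto simp: adjoint_def adjm_def fun_eq_iff R_sym)
  then show ?case using Talg.gen_A[OF gen_A] by simp
next
  case (gen_Astar i)
  have "adjoint (Astar E x i) = Astar E x i"
    using E_real[OF gen_Astar] by (auto simp: adjoint_def Astar_def fun_eq_iff)
  then show ?case using Talg.gen_Astar[OF gen_Astar] by simp
next
  case (add F G)
  then show ?case using Talg.add[OF add.IH] by (simp add: adjoint_def)
next
  case (smult F c)
  then show ?case using Talg.smult[OF smult.IH, of "cnj c"] by (simp add: adjoint_def)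
next
  case (mult F G)
  have "adjoint (mmult F G) = mmult (adjoint G) (adjoint F)"
    by (simp add: adjoint_def mmult_def fun_eq_iff mult.commute)
  then show ?case using Talg.mult[OF mult.IH(2,1)] by simp
qed

lemma Tmodule_iff: "Tmodule R D E x W \<longleftrightarrow> act.invariant W"
proof
  assume "Tmodule R D E x W"
  then show "act.invariant W"
    unfolding Tmodule_def act.invariant_def subspace_cscale
    using Talg.gen_A Talg.gen_Astar by blast
next
  assume W: "act.invariant W"
  note sub = act.invariantD(1)[OF W]
  have "mapply F w \<in> W" if "F \<in> Talg R D E x" "w \<in> W" for F w
    using that
  proof (induction arbitrary: w rule: Talg.induct)
    case (gen_A i)
    then show ?case using act.invariantD(2)[OF W] by blast
  next
    case (gen_Astar i)
    then show ?case using act.invariantD(3)[OF W] by blast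
  next
    case (add F G)
    have eq: "mapply (\<lambda>y z. F y z + G y z) w = mapply F w + mapply G w"
      by (simp add: mapply_def fun_eq_iff sum.distrib algebra_simps)
    show ?case unfolding eq using act.subspace_add[OF sub] add.IH add.prems by blast
  next
    case (smult F c)
    have eq: "mapply (\<lambda>y z. c * F y z) w = cscale c (mapply F w)"
      by (simp add: mapply_def cscale_def fun_eq_iff sum_distrib_left mult.assoc)
    show ?case unfolding eq using act.subspace_scale[OF sub] smult.IH smult.prems by blast
  next
    case (mult F G)
    then show ?case by (simp add: mapply_mmult)
  qed
  then show "Tmodule R D E x W" using sub unfolding Tmodule_def subspace_cscale by blast
qed

lemma irred_Tmodule_iff: "irred_Tmodule R D E x W \<longleftrightarrow> act.irreducible_sub W"
  unfolding irred_Tmodule_def act.irreducible_sub_def Tmodule_iff zvec_0 by blast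

lemma supp_eq: "act.supp W = {i. i \<le> D \<and> nz_on (Estar R x i) W}"
  unfolding act.supp_def nz_on_def zvec_0 ..

lemma dual_supp_eq: "act.dual_supp W = {j. j \<le> D \<and> nz_on (E j) W}"
  unfolding pq_action.supp_def[OF act.dual_action] nz_on_def zvec_0 ..

lemma endpoint_eq:
  assumes "act.irreducible_sub W"
  shows "endpoint R D x W = Min (act.supp W)" "dual_endpoint D E W = Min (act.dual_supp W)"
proof -
  show "endpoint R D x W = Min (act.supp W)"
    unfolding endpoint_def supp_eq using act.Min_supp[OF assms] 
    by (intro Least_Min) (auto simp: supp_eq)
  show "dual_endpoint D E W = Min (act.dual_supp W)"
    unfolding dual_endpoint_def dual_supp_eq using act.Min_dual_supp[OF assms] 
    by (intro Least_Min) (auto simp: dual_supp_eq)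
qed

lemma thin_iff: "thin R D x W \<longleftrightarrow> act.thin_sub W"
  unfolding thin_def act.thin_sub_def cscale_def ..

lemma Tmodule_cperp:
  assumes "Tmodule R D E x W"
  shows "Tmodule R D E x (cperp W)"
proof -
  have "mapply F v \<in> cperp W" if "F \<in> Talg R D E x" "v \<in> cperp W" for F v
    using assms that adjoint_Talg unfolding Tmodule_def cperp_def by (auto simp: cinner_adjoint)
  moreover have "csubspace (cperp W)"
    unfolding subspace_cscale[symmetric] act.subspace_def cperp_def
    by (auto simp: cinner_add_left cinner_scale_left) (simp add: cinner_def)
  ultimately show ?thesis unfolding Tmodule_def by blast
qed

lemma Tmodule_Int: "Tmodule R D E x U \<Longrightarrow> Tmodule R D E x W \<Longrightarrow> Tmodule R D E x (U \<inter> W)"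
  unfolding Tmodule_iff act.invariant_def using act.subspace_inter by auto

text \<open>\<open>W\<close> and \<open>cperp W\<close> are both invariant, so \<open>F\<close> acts
  on the two parts separately and they cannot cancel each other.\<close>

lemma component_zero:
  assumes W: "Tmodule R D E x W" and "w \<in> W" "p \<in> cperp W" "F \<in> Talg R D E x"
    and "mapply F (w + p) = 0"
  shows "mapply F w = 0" "mapply F p = 0"
proof -
  have sum: "mapply F w + mapply F p = 0" using assms(5) by (simp add: mapply_add)
  have p: "mapply F p \<in> cperp W" using Tmodule_cperp[OF W] assms unfolding Tmodule_def by blast
  have w: "mapply F w \<in> W" using W assms unfolding Tmodule_def by blast
  have "mapply F w = cscale (- 1) (mapply F p)"
    using sum by (simp add: cscale_def fun_eq_iff add_eq_0_iff)
  moreover have "cscale (- 1) (mapply F p) \<in> cperp W"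
    using Tmodule_cperp[OF W] p act.subspace_scale act.invariantD(1) unfolding Tmodule_iff by blast
  ultimately show "mapply F w = 0" using cperp_Int_zero[OF w] by simp
  then show "mapply F p = 0" using sum by simp
qed

lemma Talg_cscale_sum:
  assumes "finite I" "I \<noteq> {}" "\<And>i. i \<in> I \<Longrightarrow> M i \<in> Talg R D E x"
  shows "(\<lambda>y z. \<Sum>i\<in>I. c i * M i y z) \<in> Talg R D E x"
  using assms
proof (induction I rule: finite_ne_induct)
  case (singleton i)
  then show ?case using Talg.smult by simp
next
  case (insert i I)
  then show ?case using Talg.add[OF Talg.smult[of "M i"], of _ _ _ _ _ "c i"] by simp
qed

lemma E_Talg: assumes "j \<le> D" shows "E j \<in> Talg R D E x"
proof -
  have "E j = (\<lambda>y z. \<Sum>i\<le>D. E_entry j i * adjm R i y z)"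
    by (simp add: adjm_def sum_nat_delta R_le fun_eq_iff E_eq_entry[OF assms])
  also have "\<dots> \<in> Talg R D E x" by (rule Talg_cscale_sum) (auto intro: Talg.gen_A)
  finally show ?thesis .
qed

lemma Estar_Talg: assumes "j \<le> D" shows "Estar R x j \<in> Talg R D E x"
proof -
  obtain c where c: "\<And>y z. (if R y z = j then 1 else 0) = (\<Sum>l\<le>D. c l * E l y z)"
    using rel_in_span_E[of "\<lambda>r. if r = j then 1 else 0"] by blast
  have "Estar R x j = (\<lambda>y z. \<Sum>i\<le>D. (c i / of_nat CARD('x)) * Astar E x i y z)"
    unfolding Estar_def Astar_def adjm_def c by (auto simp: fun_eq_iff)
  also have "\<dots> \<in> Talg R D E x" by (rule Talg_cscale_sum) (auto intro: Talg.gen_Astar)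
  finally show ?thesis .
qed

text \<open>The vectors of \<open>M x\<close> are exactly the functions of the distance from
  \<open>x\<close>.\<close>

lemma Mx_perp_iff: "v \<in> Mx_perp R D x \<longleftrightarrow> (\<forall>b. (\<Sum>y\<in>UNIV. b (R x y) * cnj (v y)) = 0)"
proof -
  have h: "mapply B (hatv x) = (\<lambda>y. B y x)" for B :: "'x cmat"
    by (simp add: fun_eq_iff mapply_def hatv_def if_distrib[of "(*) _"] cong: if_cong)
  have *: "cinner (mapply (\<lambda>y z. b (R y z)) (hatv x)) v = (\<Sum>y\<in>UNIV. b (R x y) * cnj (v y))" for b
    unfolding cinner_def h
    by (intro sum.cong refl arg_cong2[of _ _ _ _ "(*)"] arg_cong[of _ _ b] R_sym)
  have "v \<in> Mx_perp R D x \<longleftrightarrow> (\<forall>b. cinner (mapply (\<lambda>y z. b (R y z)) (hatv x)) v = 0)"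
    unfolding Mx_perp_def mem_Collect_eq Ball_def BM_iff by auto
  then show ?thesis unfolding * .
qed

text \<open>Both kinds of generators can be moved onto the test function: \<open>Astar E x j\<close>
  multiplies \<open>b\<close> by a function of the distance, and \<open>adjm R j\<close> turns
  \<open>b\<close> into another such function by \<open>rel_product\<close>.\<close>

lemma Tmodule_Mx_perp: "Tmodule R D E x (Mx_perp R D x)"
  unfolding Tmodule_iff act.invariant_def
proof (intro conjI allI impI ballI)
  show "act.subspace (Mx_perp R D x)"
    unfolding act.subspace_def 
  proof (intro conjI ballI allI)
    show "0 \<in> Mx_perp R D x" unfolding Mx_perp_iff by simp
  next
    fix u v assume "u \<in> Mx_perp R D x" "v \<in> Mx_perp R D x"
    then show "u + v \<in> Mx_perp R D x"
      unfolding Mx_perp_iff by (simp add: distrib_left sum.distrib)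
  next
    fix c v assume v: "v \<in> Mx_perp R D x"
    have "(\<Sum>y\<in>UNIV. b (R x y) * cnj (cscale c v y)) = cnj c * (\<Sum>y\<in>UNIV. b (R x y) * cnj (v y))" for b
      by (simp add: cscale_def sum_distrib_left mult_ac)
    then show "cscale c v \<in> Mx_perp R D x" using v unfolding Mx_perp_iff by simp
  qed
next
  fix j v assume j: "j \<le> D" and v: "v \<in> Mx_perp R D x"
  show "mapply (Astar E x j) v \<in> Mx_perp R D x"
    unfolding Mx_perp_iff
  proof
    fix b
    let ?b = "\<lambda>r. b r * cnj (of_nat CARD('x) * E_entry j r)"
    have "(\<Sum>y\<in>UNIV. b (R x y) * cnj (mapply (Astar E x j) v y)) = (\<Sum>y\<in>UNIV. ?b (R x y) * cnj (v y))"
      by (simp add: mapply_Astar E_eq_entry[OF j] mult_ac)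
    also have "\<dots> = 0" using v unfolding Mx_perp_iff by (rule spec)
    finally show "(\<Sum>y\<in>UNIV. b (R x y) * cnj (mapply (Astar E x j) v y)) = 0" .
  qed
  show "mapply (adjm R j) v \<in> Mx_perp R D x"
    unfolding Mx_perp_iff
  proof
    fix b :: "nat \<Rightarrow> complex"
    let ?a = "\<lambda>r. if r = j then 1 else 0 :: complex"
    let ?b = "\<lambda>r. \<Sum>i\<le>D. \<Sum>k\<le>D. b i * ?a k * of_nat (intersection_no i k r)"
    have "(\<Sum>y\<in>UNIV. b (R x y) * cnj (mapply (adjm R j) v y)) =
      (\<Sum>y\<in>UNIV. \<Sum>w\<in>UNIV. b (R x y) * ?a (R y w) * cnj (v w))"
      unfolding mapply_def adjm_def cnj_sum sum_distrib_left by (intro sum.cong refl) simp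
    also have "\<dots> = (\<Sum>w\<in>UNIV. \<Sum>y\<in>UNIV. b (R x y) * ?a (R y w) * cnj (v w))" by (rule sum.swap)
    also have "\<dots> = (\<Sum>w\<in>UNIV. ?b (R x w) * cnj (v w))"
      unfolding sum_distrib_right[symmetric] rel_product[of b x ?a] ..
    also have "\<dots> = 0" using v unfolding Mx_perp_iff by (rule spec)
    finally show "(\<Sum>y\<in>UNIV. b (R x y) * cnj (mapply (adjm R j) v y)) = 0" .
  qed
qed

text \<open>The indicator of \<open>x\<close> lies in \<open>M x\<close>. This makes the endpoint of
  every irreducible module inside \<open>Mx_perp\<close> positive.\<close>

lemma Estar_0_Mx_perp: assumes "v \<in> Mx_perp R D x" shows "mapply (Estar R x 0) v = 0"
proof -
  have "(\<Sum>y\<in>UNIV. (if R x y = 0 then 1 else 0) * cnj (v y)) = 0"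
    using assms unfolding Mx_perp_iff by (rule spec)
  moreover have "(\<Sum>y\<in>UNIV. (if R x y = 0 then 1 else 0) * cnj (v y)) = (\<Sum>y\<in>UNIV. if x = y then cnj (v y) else 0)"
    by (rule sum.cong) (auto simp: R_0)
  ultimately have "v x = 0" by simp
  then show ?thesis by (auto simp: fun_eq_iff mapply_Estar R_0)
qed

lemma Vij_corner:
  assumes "v \<in> Vij R E x i j" "v \<in> W" "i \<le> D" "j \<le> D"
  shows "v \<in> act.corner W i j"
proof -
  obtain f where f: "v = (\<Sum>k\<le>i. mapply (Estar R x k) (f k))"
    using assms(1) unfolding Vij_def by (auto simp: fun_eq_iff sum_fun_apply)
  obtain g where g: "v = (\<Sum>l\<le>j. mapply (E l) (g l))"
    using assms(1) unfolding Vij_def by (auto simp: fun_eq_iff sum_fun_apply)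
  have "mapply (Estar R x k) v = 0" if "k \<le> D" "i < k" for k
    unfolding f module_hom.sum[OF module_hom_mapply]
    using that assms by (intro sum.neutral) (auto simp: act.dual.E_E)
  moreover have "mapply (E l) v = 0" if "l \<le> D" "j < l" for l
    unfolding g module_hom.sum[OF module_hom_mapply]
    using that assms by (intro sum.neutral) (auto simp: act.E_E)
  ultimately show ?thesis using assms(2) unfolding act.corner_def by blast
qed

text \<open>The weight condition is used at one value, the endpoint \<open>r\<close> of
  \<open>W\<close>. It is at most \<open>t\<close> because the corner gives both
  \<open>r \<le> i\<close> and \<open>r \<le> j\<close>. The supports of \<open>W\<close> are
  \<open>{r..D - r}\<close>, the same window in which the weights are counted.\<close>

lemma irreducible_orthogonal:
  assumes W: "act.irreducible_sub W" and perp: "W \<subseteq> Mx_perp R D x"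
    and u: "u \<in> act.corner W i j" "u \<noteq> 0" and ij: "i + j = D" "i \<le> t \<or> j \<le> t"
    and weights: "\<forall>r. 1 \<le> r \<and> r \<le> t \<longrightarrow>
         int (card {j. r \<le> j \<and> j \<le> D - r \<and> mapply (E j) \<chi> \<noteq> zvec})
            \<le> int (min_dist R D x \<chi>) - int r
       \<or> int (card {i. r \<le> i \<and> i \<le> D - r \<and> mapply (Estar R x i) \<chi> \<noteq> zvec})
            \<le> int (dual_degree D E \<chi>) - int r"
    and thin_hyp: "\<forall>W. irred_Tmodule R D E x W \<and> displacement R D E x W = 0
         \<and> endpoint R D x W \<le> t \<longrightarrow> thin R D x W"
    and w: "w \<in> W"
  shows "cinner \<chi> w = 0"
proof -
  define r where "r = Min (act.supp W)"
  note c = act.corner_forces_supp[OF W u ij(1), folded r_def]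
  have T: "Tmodule R D E x W" using act.irreducible_subD(1)[OF W] Tmodule_iff by blast
  have "0 \<notin> act.supp W" unfolding act.supp_def using Estar_0_Mx_perp perp by blast
  then have r1: "1 \<le> r" using c(2,6) by (cases "r = 0") auto
  have rt: "r \<le> t" using c(4,5) ij(2) by auto
  have "diameter R D x W = (D - r) - r"
    unfolding diameter_def supp_eq[symmetric] c(2) using c(6) by simp
  then have "displacement R D E x W = 0"
    unfolding displacement_def endpoint_eq[OF W] c(1) r_def[symmetric] using c(6) by simp
  then have "thin R D x W"
    using thin_hyp W rt endpoint_eq(1)[OF W] irred_Tmodule_iff unfolding r_def by auto
  then have thin: "act.thin_sub W" using thin_iff by blast
  obtain \<psi> p where \<psi>: "\<psi> \<in> W" "p \<in> cperp W" "\<chi> = \<psi> + p"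
    using cperp_decomposition[of W \<chi>] T unfolding Tmodule_def by blast
  have E0: "mapply (E l) \<psi> = 0" if "l \<le> D" "mapply (E l) \<chi> = 0" for l
    using component_zero(1)[OF T \<psi>(1,2) E_Talg[OF that(1)]] that(2) \<psi>(3) by simp
  have Es0: "mapply (Estar R x h) \<psi> = 0" if "h \<le> D" "mapply (Estar R x h) \<chi> = 0" for h
    using component_zero(1)[OF T \<psi>(1,2) Estar_Talg[OF that(1)]] that(2) \<psi>(3) by simp
  have Eout: "mapply (E l) \<psi> = 0" if "l \<le> D" "l \<notin> {r..D - r}" for l
    using pq_action.Es_outside_supp[OF act.dual_action \<psi>(1) that(1)] that(2) c(3) by simp
  have Esout: "mapply (Estar R x l) \<psi> = 0" if "l \<le> D" "l \<notin> {r..D - r}" for l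
    using act.Es_outside_supp[OF \<psi>(1) that(1)] that(2) c(2) by simp
  have "\<psi> = 0"
  proof -
    let ?S = "{j. r \<le> j \<and> j \<le> D - r \<and> mapply (E j) \<chi> \<noteq> zvec}"
    let ?T = "{i. r \<le> i \<and> i \<le> D - r \<and> mapply (Estar R x i) \<chi> \<noteq> zvec}"
    from weights r1 rt consider "r + card ?S \<le> min_dist R D x \<chi>" | "r + card ?T \<le> dual_degree D E \<chi>"
      by force
    then show ?thesis
    proof cases
      case 1
      show ?thesis
      proof (rule act.thin_vanishing[OF W thin])
        show "finite ?S" by (rule finite_subset[of _ "{..D}"]) auto
        show "\<psi> \<in> W" by fact
        show "mapply (E l) \<psi> = 0" if "l \<le> D" "l \<notin> ?S" for l
          using E0[OF that(1)] Eout[OF that(1)] that(2) by (auto simp: zvec_0)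
        show "mapply (Estar R x h) \<psi> = 0" if h: "h \<le> D" "h < Min (act.supp W) + card ?S" for h
        \<comment> \<open>\<open>min_dist\<close> ignores index 0; that component vanishes because
          the support of \<open>W\<close> starts at \<open>r \<ge> 1\<close>.\<close>
        proof (cases "h = 0")
          case True
          then show ?thesis using Esout[of 0] r1 by simp
        next
          case False
          have "h < min_dist R D x \<chi>" using h 1 unfolding r_def by simp
          then have "\<not> (h \<noteq> 0 \<and> h \<le> D \<and> mapply (Estar R x h) \<chi> \<noteq> zvec)"
            unfolding min_dist_def by (rule not_less_Least)
          then have "mapply (Estar R x h) \<chi> = 0" using False h(1) zvec_0 by auto
          then show ?thesis using Es0 h by blast
        qed
      qed
    next
      case 2
      show ?thesis
      proof (rule pq_action.thin_vanishing[OF act.dual_action act.dual_irr[OF W] act.thin_imp_dual_thin[OF W thin]])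
        show "finite ?T" by (rule finite_subset[of _ "{..D}"]) auto
        show "\<psi> \<in> W" by fact
        show "mapply (Estar R x l) \<psi> = 0" if "l \<le> D" "l \<notin> ?T" for l
          using Es0[OF that(1)] Esout[OF that(1)] that(2) by (auto simp: zvec_0)
        show "mapply (E h) \<psi> = 0" if h: "h \<le> D" "h < Min (act.dual_supp W) + card ?T" for h
        proof (cases "h = 0")
          case True
          then show ?thesis using Eout[of 0] r1 by simp
        next
          case False
          have "h < dual_degree D E \<chi>" using h 2 unfolding c(1) by simp
          then have "\<not> (h \<noteq> 0 \<and> h \<le> D \<and> mapply (E h) \<chi> \<noteq> zvec)"
            unfolding dual_degree_def by (rule not_less_Least)
          then have "mapply (E h) \<chi> = 0" using False h(1) zvec_0 by auto
          then show ?thesis using E0 h by blast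
        qed
      qed
    qed
  qed
  then show ?thesis using \<psi> w unfolding cperp_def by simp
qed

text \<open>Induction on dimension: a reducible \<open>U\<close> splits as \<open>U1\<close> plus
  its complement in \<open>U\<close>, and by \<open>component_zero\<close> both parts of
  \<open>v\<close> stay in the corners of these smaller modules.\<close>

lemma module_orthogonal:
  assumes weights: "\<forall>r. 1 \<le> r \<and> r \<le> t \<longrightarrow>
         int (card {j. r \<le> j \<and> j \<le> D - r \<and> mapply (E j) \<chi> \<noteq> zvec})
            \<le> int (min_dist R D x \<chi>) - int r
       \<or> int (card {i. r \<le> i \<and> i \<le> D - r \<and> mapply (Estar R x i) \<chi> \<noteq> zvec})
            \<le> int (dual_degree D E \<chi>) - int r"
    and thin_hyp: "\<forall>W. irred_Tmodule R D E x W \<and> displacement R D E x W = 0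
         \<and> endpoint R D x W \<le> t \<longrightarrow> thin R D x W"
    and ij: "i + j = D" "i \<le> t \<or> j \<le> t" and F: "F \<in> Talg R D E x"
    and "Tmodule R D E x U" "U \<subseteq> Mx_perp R D x" "v \<in> act.corner U i j"
  shows "cinner (mapply F \<chi>) v = 0"
  using assms(6-8)
proof (induction "rdim U" arbitrary: U v rule: less_induct)
  case less
  have vU: "v \<in> U" using less.prems(3) unfolding act.corner_def by blast
  show ?case
  proof (cases "v = 0")
    case True
    then show ?thesis by (simp add: cinner_zero_right)
  next
    case v0: False
    show ?thesis
    proof (cases "act.irreducible_sub U")
      case True
      \<comment> \<open>The corner vector \<open>v\<close> only shows that \<open>U\<close> meets
        V(i, j). The code is then orthogonal to all of \<open>U\<close>, in particular to the image
        of \<open>v\<close> under the adjoint of \<open>F\<close>.\<close>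
      have "mapply (adjoint F) v \<in> U"
        using less.prems(1) adjoint_Talg[OF F] vU unfolding Tmodule_def by blast
      then show ?thesis unfolding cinner_adjoint
        by (rule irreducible_orthogonal[OF True less.prems(2,3) v0 ij weights thin_hyp])
    next
      case False
      have "U \<noteq> {0}" using vU v0 by blast
      then obtain U1 where U1: "Tmodule R D E x U1" "U1 \<subseteq> U" "U1 \<noteq> {0}" "U1 \<noteq> U"
        using False less.prems(1) unfolding act.irreducible_sub_def Tmodule_iff by blast
      let ?U2 = "U \<inter> cperp U1"
      have U2: "Tmodule R D E x ?U2" by (intro Tmodule_Int less.prems(1) Tmodule_cperp U1(1))
      have sub: "csubspace U" "csubspace U1" "csubspace ?U2"
        using less.prems(1) U1(1) U2 unfolding Tmodule_def by blast+
      have "0 \<in> U1" using sub(2) unfolding csubspace_def zvec_0 by blast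
      then obtain z where z: "z \<in> U1" "z \<noteq> 0" using U1(3) by blast
      then have "z \<notin> ?U2" using cperp_Int_zero by blast
      then have lt: "rdim U1 < rdim U" "rdim ?U2 < rdim U"
        using U1(2,4) z(1) by (auto intro!: rdim_psubset sub)
      obtain w p where wp: "w \<in> U1" "p \<in> cperp U1" "v = w + p"
        using cperp_decomposition[OF sub(2)] by blast
      have "p = v - w" using wp(3) by simp
      then have "p \<in> U" using act.subspace_diff[of U v w] sub(1) vU wp(1) U1(2) 
        unfolding subspace_cscale by blast
      have "mapply (Estar R x k) w = 0 \<and> mapply (Estar R x k) p = 0" if "k \<le> D" "i < k" for k
        using component_zero[OF U1(1) wp(1,2) Estar_Talg[OF that(1)]] that less.prems(3) wp(3)
        unfolding act.corner_def by auto
      moreover have "mapply (E l) w = 0 \<and> mapply (E l) p = 0" if "l \<le> D" "j < l" for l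
        using component_zero[OF U1(1) wp(1,2) E_Talg[OF that(1)]] that less.prems(3) wp(3)
        unfolding act.corner_def by auto
      ultimately have "w \<in> act.corner U1 i j" "p \<in> act.corner ?U2 i j"
        using wp(1,2) \<open>p \<in> U\<close> unfolding act.corner_def by auto
      then have "cinner (mapply F \<chi>) w = 0" "cinner (mapply F \<chi>) p = 0"
        using less.hyps[OF lt(1) U1(1)] less.hyps[OF lt(2) U2] U1(2) less.prems(2) by blast+
      then show ?thesis unfolding wp(3) cinner_add_right by simp
    qed
  qed
qed

end

theorem theorem5p2:
  fixes R :: "'x::finite \<Rightarrow> 'x \<Rightarrow> nat" and D :: nat and E :: "nat \<Rightarrow> 'x cmat"
    and x :: 'x and \<chi> :: "'x cvec" and t :: nat
  assumes scheme: "sym_assoc_scheme R D"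
    and idem: "prim_idempotents R D E"
    and met: "metric R"
    and comet: "cometric D E"
    and code: "is_code R E \<chi>"
    and t_range: "1 \<le> t" "t \<le> D"
    and weights: "\<forall>r. 1 \<le> r \<and> r \<le> t \<longrightarrow>
         int (card {j. r \<le> j \<and> j \<le> D - r \<and> mapply (E j) \<chi> \<noteq> zvec})
            \<le> int (min_dist R D x \<chi>) - int r
       \<or> int (card {i. r \<le> i \<and> i \<le> D - r \<and> mapply (Estar R x i) \<chi> \<noteq> zvec})
            \<le> int (dual_degree D E \<chi>) - int r"
    and thin_hyp: "\<forall>W. irred_Tmodule R D E x W \<and> displacement R D E x W = 0
         \<and> endpoint R D x W \<le> t \<longrightarrow> thin R D x W"
  shows "(\<forall>F\<in>Talg R D E x. \<forall>i. 1 \<le> i \<and> i \<le> t \<longrightarrow>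
            (\<forall>v \<in> Vij R E x i (D - i) \<inter> Mx_perp R D x. cinner (mapply F \<chi>) v = 0))
       \<and> (\<forall>F\<in>Talg R D E x. \<forall>j. 1 \<le> j \<and> j \<le> t \<longrightarrow>
            (\<forall>v \<in> Vij R E x (D - j) j \<inter> Mx_perp R D x. cinner (mapply F \<chi>) v = 0))"
proof -
  interpret pointed_pq_scheme R D E x
    using scheme idem met comet t_range by unfold_locales auto
  \<comment> \<open>One statement for both claims: they differ only in which of the two indices is
    bounded by \<open>t\<close>.\<close>
  have main: "cinner (mapply F \<chi>) v = 0"
    if "F \<in> Talg R D E x" "i + j = D" "i \<le> t \<or> j \<le> t" "v \<in> Vij R E x i j \<inter> Mx_perp R D x"
    for F i j v
  proof (rule module_orthogonal[OF weights thin_hyp that(2,3,1) Tmodule_Mx_perp order.refl])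
    show "v \<in> act.corner (Mx_perp R D x) i j"
      using that by (intro Vij_corner) auto
  qed
  show ?thesis
  proof (intro conjI ballI allI impI)
    fix F i v assume "F \<in> Talg R D E x" "1 \<le> i \<and> i \<le> t" "v \<in> Vij R E x i (D - i) \<inter> Mx_perp R D x"
    then show "cinner (mapply F \<chi>) v = 0" using t_range by (intro main[of F i "D - i"]) auto
  next
    fix F j v assume "F \<in> Talg R D E x" "1 \<le> j \<and> j \<le> t" "v \<in> Vij R E x (D - j) j \<inter> Mx_perp R D x"
    then show "cinner (mapply F \<chi>) v = 0" using t_range by (intro main[of F "D - j" j]) auto
  qed
qed

end
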